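(* Let $\mathcal V,\mathcal W,\mathcal Z$ be commutative topological groups, $\mathfrak S\subset\mathfrak P(X)$ an interval system, $\mu:\mathfrak S\to\mathcal W$ a measure, and $L:\mathcal V\times\mathcal W\to\mathcal Z$ a biadditive pairing which is continuous in its second variable. Let $f:X\to\mathcal V$ be a function. Then the integral $\int L(f,\mu)$, if it exists, is unique. Moreover, the integral of $f$ exists if and only if for each neighborhood $\mathcal T$ of $0$ in $\mathcal Z$ there exists an envelope $\mathcal A$ approximating $f$ such that $$\int^{\mathrm p}L(\mathcal A,\mu)-\int^{\mathrm p}L(\mathcal A,\mu)\subset\mathcal T .$$
   Context: Conventions. "Countable" includes finite. All commutative topological groups are assumed complete and Hausdorff. Neighborhoods need not be open. $\mathfrak P(X)$ is the power set of $X$. For subsets $A,B$ of a group, $A-B=\{a-b: a\in A,b\in B\}$. Interval system: a family $\mathfrak S\subset\mathfrak P(X)$ such that for all $A,B\in\mathfrak S$ each of $A\setminus B$ and $A\cap B$ is the union of a countable family of pairwise disjoint elements of $\mathfrak S$. Absolute sum: for a countable family $\{a_\lambda\}_{\lambda\in\Lambda}$ in a commutative topological group, $\sum^{\mathrm{abs}}_{\lambda\in\Lambda}a_\lambda=a$ means: for each neighborhood $\mathcal T$ of $0$ there is a finite $\Xi\subset\Lambda$ such that $\sum_{\lambda\in\Omega}a_\lambda\in a-\mathcal T$ for all finite $\Omega$ with $\Xi\subset\Omega\subset\Lambda$. Measure: $\mu:\mathfrak S\to\mathcal W$ is a measure if $\mu(A)=\sum^{\mathrm{abs}}_{\lambda}\mu(A_\lambda)$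 (existence included) whenever $A\in\mathfrak S$ is the disjoint union of a countable family $A_\lambda\in\mathfrak S$. Step-function: a function $s=\sum_{j\in J}c_j\chi_{E_j}:X\to\mathcal V$ with $J$ finite, $c_j\in\mathcal V$, $E_j\in\mathfrak S$ (the $E_j$ need not be disjoint). Envelope: for $\mathcal A\subset\mathcal V\times X$ and $D\subset X$ put $\mathcal A^D=\{v: (v,x)\in\mathcal A\text{ for all }x\in D\}$. $\mathcal A$ is an envelope (of sets in $\mathcal V$ with respect to $\mathfrak S$) if (i) $\mathcal A$ contains the graph $\{(s(x),x):x\in X\}$ of some step-function $s$, and (ii) there is a countable $\mathfrak D\subset\mathfrak S$ with $\mathcal A=\bigl(\bigcup_{D\in\mathfrak D}\mathcal A^D\times D\bigr)\cup\bigl(\{0\}\times(X\setminus\bigcup\mathfrak D)\bigr)$. $\mathcal A$ approximates $f:X\to\mathcal V$ if it contains the graph $\{(f(x),x):x\in X\}$. Bilinear sum: $\int^{\mathrm p}L(\mathcal A,\mu)$ is the closure in $\mathcal Z$ of the set of all $\sum_{j\in J}L(c_j,\mu(E_j))$ with $J$ finite, $c_j\in\mathcal V$, $E_j\in\mathfrak S$, such that the graph of $\sum_{j\in J}c_j\chi_{E_j}$ is contained in $\mathcal A$. Integral: $a\in\mathcal Z$ is an integral of $f$ (with respect to $L,\mu$), written $\int L(f,\mu)=a$, if for each neighborhood $\mathcal T$ of $0$ in $\mathcal Z$ there is an envelope $\mathcal A$ approximating $f$ with $\int^{\mathrm p}L(\mathcal A,\mu)\subset a+\mathcal T$. *)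

theory Defs
  imports "HOL-Analysis.Analysis"
begin

text \<open>
  Conventions. The ground set is a carrier \<open>X\<close>; functions on \<open>X\<close> and set functions on \<open>\<SS>\<close> are
  total HOL functions whose values outside \<open>X\<close> and \<open>\<SS>\<close> are never constrained.
  Finite and countable families are indexed by subsets of \<^typ>\<open>nat\<close>, with no loss of generality.
  A set \<open>T\<close>, not necessarily open, is a neighborhood of 0 iff \<^prop>\<open>0 \<in> interior T\<close>.
  A complete Hausdorff commutative topological group is a type of sort
  \<open>{topological_ab_group_add, uniform_topological_group_add, complete_uniform_space, t2_space}\<close>;
  the uniformity of such a type is necessarily the canonical group uniformity, because it induces
  the topology and makes the group operations uniformly continuous.
\<close>

definition interval_system :: "'x set \<Rightarrow> 'x set set \<Rightarrow> bool" where
  "interval_system X \<SS> \<longleftrightarrow> \<SS> \<subseteq> Pow X \<and>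
     (\<forall>A\<in>\<SS>. \<forall>B\<in>\<SS>.
        (\<exists>\<D>\<subseteq>\<SS>. countable \<D> \<and> disjoint \<D> \<and> A - B = \<Union>\<D>) \<and>
        (\<exists>\<D>\<subseteq>\<SS>. countable \<D> \<and> disjoint \<D> \<and> A \<inter> B = \<Union>\<D>))"

text \<open>
  The library's \<open>has_sum\<close> (convergence of the net of finite partial sums) is the absolute sum:
  the sets \<open>a - T\<close>, with \<open>T\<close> a neighborhood of 0, are exactly the neighborhoods of \<open>a\<close>.
\<close>

definition interval_system_measure ::
  "'x set set \<Rightarrow> ('x set \<Rightarrow> 'w::topological_ab_group_add) \<Rightarrow> bool" where
  "interval_system_measure \<SS> \<mu> \<longleftrightarrow>
     (\<forall>A\<in>\<SS>. \<forall>(\<Lambda>::nat set) F. F ` \<Lambda> \<subseteq> \<SS> \<longrightarrow> disjoint_family_on F \<Lambda> \<longrightarrow> A = (\<Union>i\<in>\<Lambda>. F i) \<longrightarrow>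
        ((\<lambda>i. \<mu> (F i)) has_sum \<mu> A) \<Lambda>)"

definition biadditive ::
  "('v::ab_group_add \<Rightarrow> 'w::ab_group_add \<Rightarrow> 'z::ab_group_add) \<Rightarrow> bool" where
  "biadditive L \<longleftrightarrow> (\<forall>v. Modules.additive (L v)) \<and> (\<forall>w. Modules.additive (\<lambda>v. L v w))"

text \<open>The function \<open>\<Sum>j\<in>J. c\<^sub>j \<chi>\<^bsub>E\<^sub>j\<^esub>\<close>.\<close>

definition step_sum ::
  "nat set \<Rightarrow> (nat \<Rightarrow> 'v::ab_group_add) \<Rightarrow> (nat \<Rightarrow> 'x set) \<Rightarrow> 'x \<Rightarrow> 'v" where
  "step_sum J c E x = (\<Sum>j\<in>J. if x \<in> E j then c j else 0)"

definition step_function ::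
  "'x set \<Rightarrow> 'x set set \<Rightarrow> ('x \<Rightarrow> 'v::ab_group_add) \<Rightarrow> bool" where
  "step_function X \<SS> s \<longleftrightarrow>
     (\<exists>J c E. finite J \<and> E ` J \<subseteq> \<SS> \<and> (\<forall>x\<in>X. s x = step_sum J c E x))"

definition value_graph :: "'x set \<Rightarrow> ('x \<Rightarrow> 'v) \<Rightarrow> ('v \<times> 'x) set" where
  "value_graph X f = {(f x, x) | x. x \<in> X}"

definition common_values :: "('v \<times> 'x) set \<Rightarrow> 'x set \<Rightarrow> 'v set" where
  "common_values \<A> D = {v. \<forall>x\<in>D. (v, x) \<in> \<A>}"

definition envelope ::
  "'x set \<Rightarrow> 'x set set \<Rightarrow> ('v::ab_group_add \<times> 'x) set \<Rightarrow> bool" where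
  "envelope X \<SS> \<A> \<longleftrightarrow> \<A> \<subseteq> UNIV \<times> X \<and>
     (\<exists>s. step_function X \<SS> s \<and> value_graph X s \<subseteq> \<A>) \<and>
     (\<exists>\<D>\<subseteq>\<SS>. countable \<D> \<and>
        \<A> = (\<Union>D\<in>\<D>. common_values \<A> D \<times> D) \<union> {0} \<times> (X - \<Union>\<D>))"

definition approximates :: "'x set \<Rightarrow> ('v \<times> 'x) set \<Rightarrow> ('x \<Rightarrow> 'v) \<Rightarrow> bool" where
  "approximates X \<A> f \<longleftrightarrow> value_graph X f \<subseteq> \<A>"

definition bilinear_sum ::
  "'x set \<Rightarrow> 'x set set \<Rightarrow> ('v::ab_group_add \<Rightarrow> 'w \<Rightarrow> 'z::topological_ab_group_add) \<Rightarrow>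
   ('x set \<Rightarrow> 'w) \<Rightarrow> ('v \<times> 'x) set \<Rightarrow> 'z set" where
  "bilinear_sum X \<SS> L \<mu> \<A> =
     closure {\<Sum>j\<in>J. L (c j) (\<mu> (E j)) | J c E.
       finite J \<and> E ` J \<subseteq> \<SS> \<and> value_graph X (step_sum J c E) \<subseteq> \<A>}"

definition is_integral ::
  "'x set \<Rightarrow> 'x set set \<Rightarrow> ('v::ab_group_add \<Rightarrow> 'w \<Rightarrow> 'z::topological_ab_group_add) \<Rightarrow>
   ('x set \<Rightarrow> 'w) \<Rightarrow> ('x \<Rightarrow> 'v) \<Rightarrow> 'z \<Rightarrow> bool" where
  "is_integral X \<SS> L \<mu> f a \<longleftrightarrow>
     (\<forall>T. 0 \<in> interior T \<longrightarrow>
        (\<exists>\<A>. envelope X \<SS> \<A> \<and> approximates X \<A> f \<and>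
              bilinear_sum X \<SS> L \<mu> \<A> \<subseteq> {a + t | t. t \<in> T}))"

end

(* Two envelopes of the same f have arbitrarily close step integrals. Where the constancy sets D and D'
   of the two envelopes admit a common value, tile the countably many intersections of D and D' by a
   disjoint family C with common values v. Outside the union of C at least one of the two envelopes
   forces f = 0, and 0 is admissible for both. Hence any step function in either envelope can be changed
   on finitely many tiles, inside that envelope, until its integral is close to the finite sum of
   L (v K) (mu K) over K in F, for every sufficiently large finite subset F of C. Uniqueness follows
   because the group is Hausdorff; existence follows because step integrals chosen from ever smaller
   envelopes form a Cauchy net. *)

theory Submission
  imports Defs
begin

text \<open>The values \<open>v K\<close> are arbitrary common values, so the sum of
  \<open>L (v K) (\<mu> K)\<close> over an infinite \<open>\<C>\<close> need not converge. Hence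
  both envelopes are compared with one finite partial sum, and the comparison holds for all finite
  \<open>F\<close> beyond a threshold: each envelope has its own threshold, and the union of the two
  serves both. Tilings are countable, but a step function can be altered on finitely many tiles
  only, so an infinite remainder always has to be made small. Since \<open>L\<close> is merely
  additive in its first variable, no estimate in the values is available; every bound comes from the
  convergence of sums over tilings.\<close>

section \<open>Tilings: countable disjoint families from the interval system\<close>

text \<open>Empty tiles are excluded so that every tile has a point at which a step function can be
  evaluated, and so that tilings of disjoint sets share no member.\<close>

definition tiles :: "'x set set \<Rightarrow> 'x set set \<Rightarrow> 'x set \<Rightarrow> bool" where
  "tiles \<SS> P A \<longleftrightarrow> P \<subseteq> \<SS> \<and> {} \<notin> P \<and> countable P \<and> disjoint P \<and> \<Union>P = A"

lemma tilesI:
  assumes "D \<subseteq> \<SS>" "countable D" "disjoint D" "A = \<Union>D"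
  shows "tiles \<SS> (D - {{}}) A"
  using assms unfolding tiles_def by (auto simp: disjoint_def)

lemma tiles_UN:
  assumes "countable I" "disjoint_family_on A I" "\<And>i. i \<in> I \<Longrightarrow> tiles \<SS> (P i) (A i)"
  shows "tiles \<SS> (\<Union>i\<in>I. P i) (\<Union>i\<in>I. A i)"
proof -
  have "disjoint (\<Union>i\<in>I. P i)"
  proof (rule disjointI)
    fix K L assume "K \<in> (\<Union>i\<in>I. P i)" "L \<in> (\<Union>i\<in>I. P i)" and ne: "K \<noteq> L"
    then obtain i j where ij: "i \<in> I" "K \<in> P i" "j \<in> I" "L \<in> P j" by blast
    have sub: "K \<subseteq> A i" "L \<subseteq> A j" using assms(3) ij unfolding tiles_def by auto
    show "K \<inter> L = {}"
    proof (cases "i = j")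
      case True
      then show ?thesis using assms(3)[OF ij(1)] ij ne unfolding tiles_def disjoint_def by auto
    next
      case False
      then show ?thesis using assms(2) ij sub unfolding disjoint_family_on_def by blast
    qed
  qed
  moreover have "countable (\<Union>i\<in>I. P i)"
    using assms(1,3) unfolding tiles_def by auto
  moreover have "(\<Union>i\<in>I. P i) \<subseteq> \<SS>" "{} \<notin> (\<Union>i\<in>I. P i)"
    using assms(3) unfolding tiles_def by blast+
  moreover have "\<Union>(\<Union>i\<in>I. P i) = (\<Union>i\<in>I. A i)"
    using assms(3) unfolding tiles_def by fastforce
  ultimately show ?thesis unfolding tiles_def by simp
qed

lemma tiles_Un:
  assumes "tiles \<SS> P A" "tiles \<SS> Q B" "A \<inter> B = {}"
  shows "tiles \<SS> (P \<union> Q) (A \<union> B)"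
proof -
  have "tiles \<SS> (\<Union>b\<in>UNIV. if b then P else Q) (\<Union>b\<in>UNIV. if b then A else B)"
    by (rule tiles_UN) (use assms in \<open>auto simp: disjoint_family_on_def split: if_splits\<close>)
  then show ?thesis by (simp add: UNIV_bool Un_commute)
qed

lemma tiles_subset: "tiles \<SS> P A \<Longrightarrow> Q \<subseteq> P \<Longrightarrow> tiles \<SS> Q (\<Union>Q)"
  unfolding tiles_def by (meson countable_subset pairwise_subset subset_trans subsetD)

lemma tiles_self: "E \<in> \<SS> \<Longrightarrow> tiles \<SS> ({E} - {{}}) E"
  by (rule tilesI) auto

section \<open>Existence and refinement of tilings in an interval system\<close>

locale interval_system_on =
  fixes X :: "'x set" and \<SS> :: "'x set set"
  assumes interval_system: "interval_system X \<SS>"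
begin

abbreviation tileable :: "'x set \<Rightarrow> bool" where
  "tileable A \<equiv> \<exists>P. tiles \<SS> P A"

lemma tileable_UN:
  assumes "countable I" "disjoint_family_on A I" "\<And>i. i \<in> I \<Longrightarrow> tileable (A i)"
  shows "tileable (\<Union>i\<in>I. A i)"
proof -
  obtain P where "\<And>i. i \<in> I \<Longrightarrow> tiles \<SS> (P i) (A i)" using assms(3) by metis
  then have "tiles \<SS> (\<Union>i\<in>I. P i) (\<Union>i\<in>I. A i)" by (rule tiles_UN[OF assms(1,2)])
  then show ?thesis by (rule exI)
qed

lemma tileable_Diff_Int_basic:
  assumes "A \<in> \<SS>" "B \<in> \<SS>"
  shows "tileable (A - B)" "tileable (A \<inter> B)"
proof -
  have "\<exists>D\<subseteq>\<SS>. countable D \<and> disjoint D \<and> A - B = \<Union>D"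
    "\<exists>D\<subseteq>\<SS>. countable D \<and> disjoint D \<and> A \<inter> B = \<Union>D"
    using interval_system assms unfolding interval_system_def by simp_all
  then obtain D D' where D: "D \<subseteq> \<SS>" "countable D" "disjoint D" "A - B = \<Union>D"
    and D': "D' \<subseteq> \<SS>" "countable D'" "disjoint D'" "A \<inter> B = \<Union>D'"
    by (elim exE conjE)
  have "tiles \<SS> (D - {{}}) (A - B)" "tiles \<SS> (D' - {{}}) (A \<inter> B)"
    using tilesI[OF D] tilesI[OF D'] .
  then show "tileable (A - B)" "tileable (A \<inter> B)" by blast+
qed

lemma tileable_Diff_Int:
  assumes "tileable A" "B \<in> \<SS>"
  shows "tileable (A - B)" "tileable (A \<inter> B)"
proof -
  obtain P where P: "tiles \<SS> P A" using assms(1) by blast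
  have dis: "disjoint_family_on (\<lambda>K. K - B) P" "disjoint_family_on (\<lambda>K. K \<inter> B) P"
    using P unfolding tiles_def disjoint_family_on_def disjoint_def by blast+
  have cov: "A - B = (\<Union>K\<in>P. K - B)" "A \<inter> B = (\<Union>K\<in>P. K \<inter> B)"
    using P unfolding tiles_def by auto
  have "countable P" "P \<subseteq> \<SS>" using P unfolding tiles_def by auto
  then have "tileable (\<Union>K\<in>P. K - B)" "tileable (\<Union>K\<in>P. K \<inter> B)"
    by (intro tileable_UN dis tileable_Diff_Int_basic; use assms(2) in auto)+
  then show "tileable (A - B)" "tileable (A \<inter> B)" using cov by simp_all
qed

text \<open>Finiteness is essential: for half-open intervals of the line, removing an infinite
  family can leave an uncountable set without interior, which no countable family of intervals
  tiles.\<close>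

lemma tileable_Diff_finite:
  assumes "finite F" "F \<subseteq> \<SS>" "tileable A"
  shows "tileable (A - \<Union>F)"
  using assms
proof (induction F)
  case (insert B F)
  have "A - \<Union>(insert B F) = (A - \<Union>F) - B" by auto
  then show ?case using insert tileable_Diff_Int(1)[of "A - \<Union>F" B] by simp
qed simp

text \<open>Each point goes to the first set of an enumeration of \<open>\<Q>\<close> that contains
  it. The resulting pieces \<open>A \<inter> disjointed g n\<close> remove only finitely many sets,
  so they are tileable. The empty set is treated apart because an empty \<open>\<Q>\<close> has no
  enumeration by \<open>nat\<close>.\<close>

lemma tileable_refine:
  assumes "tileable A" "countable \<Q>" "\<Q> \<subseteq> \<SS>" "A \<subseteq> \<Union>\<Q>"
  shows "\<exists>P. tiles \<SS> P A \<and> (\<forall>K\<in>P. \<exists>Q\<in>\<Q>. K \<subseteq> Q)"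
proof (cases "A = {}")
  case True
  then have "tiles \<SS> {} A" by (simp add: tiles_def)
  then show ?thesis by blast
next
  case False
  then have "\<Q> \<noteq> {}" using assms(4) by auto
  then obtain g :: "nat \<Rightarrow> 'x set" where g: "\<Q> = range g"
    using assms(2) by (metis range_from_nat_into)
  define B where "B n = A \<inter> disjointed g n" for n
  have tB: "tileable (B n)" for n
  proof -
    have "tileable (A \<inter> g n - \<Union>(g ` {0..<n}))"
      using assms g by (intro tileable_Diff_finite tileable_Diff_Int) auto
    moreover have "A \<inter> g n - \<Union>(g ` {0..<n}) = B n" by (auto simp: B_def disjointed_def)
    ultimately show ?thesis by simp
  qed
  then obtain P where P: "\<And>n. tiles \<SS> (P n) (B n)" by metis
  have "disjoint_family B"
    using disjoint_family_disjointed[of g] unfolding B_def disjoint_family_on_def by blast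
  moreover have "(\<Union>n. B n) = A"
    using assms(4) UN_disjointed_eq[of g] unfolding B_def g by blast
  ultimately have "tiles \<SS> (\<Union>n. P n) A"
    using tiles_UN[of UNIV B \<SS> P] P by simp
  moreover have "\<exists>Q\<in>\<Q>. K \<subseteq> Q" if "K \<in> P n" for K n
    using P[of n] that unfolding tiles_def B_def disjointed_def g by blast
  ultimately show ?thesis by blast
qed

lemma tileable_Union:
  assumes "countable \<Q>" "\<Q> \<subseteq> \<SS>"
  shows "\<exists>P. tiles \<SS> P (\<Union>\<Q>) \<and> (\<forall>K\<in>P. \<exists>Q\<in>\<Q>. K \<subseteq> Q)"
proof (cases "\<Q> = {}")
  case True
  then have "tiles \<SS> {} (\<Union>\<Q>)" by (simp add: tiles_def)
  then show ?thesis by blast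
next
  case False
  then obtain g :: "nat \<Rightarrow> 'x set" where g: "\<Q> = range g"
    using assms(1) by (metis range_from_nat_into)
  have "tileable (disjointed g n)" for n
  proof -
    have "g ` {0..<n} \<subseteq> \<SS>" "g n \<in> \<SS>" using assms(2) g by auto
    then show ?thesis
      unfolding disjointed_def using tiles_self[of "g n" \<SS>] by (blast intro: tileable_Diff_finite)
  qed
  then have "tileable (\<Union>n. disjointed g n)"
    using disjoint_family_disjointed[of g] by (intro tileable_UN) auto
  then have "tileable (\<Union>\<Q>)" unfolding UN_disjointed_eq g .
  then show ?thesis using tileable_refine[OF _ assms] by blast
qed

text \<open>Splitting along \<open>E\<close> into \<open>A - E\<close> and
  \<open>A \<inter> E\<close> decides \<open>E\<close>. Both halves are tiled inside the previous
  tiles, and a subset of a tile inherits all decisions already made on it.\<close>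

lemma tileable_decide:
  assumes "finite \<E>" "\<E> \<subseteq> \<SS>" "tiles \<SS> P A"
  shows "\<exists>Q. tiles \<SS> Q A \<and> (\<forall>K\<in>Q. \<exists>K'\<in>P. K \<subseteq> K') \<and> (\<forall>K\<in>Q. \<forall>E\<in>\<E>. K \<subseteq> E \<or> K \<inter> E = {})"
  using assms
proof (induction \<E>)
  case empty
  then show ?case by (intro exI[of _ P]) auto
next
  case (insert E \<E>)
  have "\<E> \<subseteq> \<SS>" using insert.prems(1) by simp
  from insert.IH[OF this insert.prems(2)] obtain Q where Q: "tiles \<SS> Q A" "\<forall>K\<in>Q. \<exists>K'\<in>P. K \<subseteq> K'"
    "\<forall>K\<in>Q. \<forall>E\<in>\<E>. K \<subseteq> E \<or> K \<inter> E = {}" by (elim exE conjE)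
  have sub: "Q \<subseteq> \<SS>" "countable Q" "\<Union>Q = A" using Q(1) unfolding tiles_def by auto
  have E: "E \<in> \<SS>" using insert by simp
  have til: "tileable (A - E)" "tileable (A \<inter> E)"
    using tileable_Diff_Int[OF _ E, of A] Q(1) by blast+
  have "\<exists>R. tiles \<SS> R (A - E) \<and> (\<forall>K\<in>R. \<exists>Q'\<in>Q. K \<subseteq> Q')"
    by (rule tileable_refine[OF til(1) sub(2,1)]) (use sub(3) in auto)
  moreover have "\<exists>R. tiles \<SS> R (A \<inter> E) \<and> (\<forall>K\<in>R. \<exists>Q'\<in>Q. K \<subseteq> Q')"
    by (rule tileable_refine[OF til(2) sub(2,1)]) (use sub(3) in auto)
  ultimately obtain R1 R2 where R: "tiles \<SS> R1 (A - E)" "\<forall>K\<in>R1. \<exists>Q'\<in>Q. K \<subseteq> Q'"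
    "tiles \<SS> R2 (A \<inter> E)" "\<forall>K\<in>R2. \<exists>Q'\<in>Q. K \<subseteq> Q'" by (elim exE conjE)
  have "tiles \<SS> (R1 \<union> R2) ((A - E) \<union> (A \<inter> E))" by (rule tiles_Un[OF R(1,3)]) auto
  moreover have "(A - E) \<union> (A \<inter> E) = A" by auto
  ultimately have t: "tiles \<SS> (R1 \<union> R2) A" by simp
  have "\<forall>K\<in>R1 \<union> R2. \<exists>Q'\<in>Q. K \<subseteq> Q'" using R(2,4) by (simp add: ball_Un)
  moreover have "K \<subseteq> E \<or> K \<inter> E = {}" if "K \<in> R1 \<union> R2" for K
    using R(1,3) that unfolding tiles_def by blast
  moreover have "K \<subseteq> E' \<or> K \<inter> E' = {}" if "K \<subseteq> Q'" "Q' \<in> Q" "E' \<in> \<E>" for K Q' E'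
    using Q(3) that by blast
  ultimately have "\<forall>K\<in>R1 \<union> R2. \<forall>E'\<in>insert E \<E>. K \<subseteq> E' \<or> K \<inter> E' = {}"
    by (metis insertE)
  moreover have "\<forall>K\<in>R1 \<union> R2. \<exists>K'\<in>P. K \<subseteq> K'"
    using Q(2) \<open>\<forall>K\<in>R1 \<union> R2. \<exists>Q'\<in>Q. K \<subseteq> Q'\<close> by (meson subset_trans)
  ultimately show ?case using t by (intro exI[of _ "R1 \<union> R2"]) simp
qed

end

section \<open>Step integrals as absolute sums over tilings\<close>

lemma has_sum_finite_sum:
  fixes f :: "'j \<Rightarrow> 'a \<Rightarrow> 'b::topological_comm_monoid_add"
  assumes "finite J" "\<And>j. j \<in> J \<Longrightarrow> (f j has_sum a j) A"
  shows "((\<lambda>x. \<Sum>j\<in>J. f j x) has_sum (\<Sum>j\<in>J. a j)) A"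
  using assms by (induction J) (auto intro: has_sum_add)

lemma step_sum_tile:
  assumes "x \<in> K" "\<And>j. j \<in> J \<Longrightarrow> K \<subseteq> E j \<or> K \<inter> E j = {}"
  shows "step_sum J c E x = (\<Sum>j\<in>J. if K \<subseteq> E j then c j else 0)"
  unfolding step_sum_def by (rule sum.cong) (use assms in auto)

locale measure_pairing = interval_system_on X \<SS>
  for X :: "'x set" and \<SS> :: "'x set set" +
  fixes \<mu> :: "'x set \<Rightarrow> 'w::topological_ab_group_add"
    and L :: "'v::ab_group_add \<Rightarrow> 'w \<Rightarrow> 'z::{topological_ab_group_add, uniform_topological_group_add}"
  assumes measure: "interval_system_measure \<SS> \<mu>"
    and biadditive: "biadditive L"
    and continuous_right: "continuous_on UNIV (L v)"
begin

lemma additive_left: "Modules.additive (\<lambda>v. L v w)"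
  using biadditive unfolding biadditive_def by blast

lemma L_zero_left [simp]: "L 0 w = 0"
  using additive.zero[OF additive_left] .

lemma L_diff_left: "L (u - v) w = L u w - L v w"
  using additive.diff[OF additive_left] .

lemma L_sum_left: "L (\<Sum>i\<in>I. u i) w = (\<Sum>i\<in>I. L (u i) w)"
  using additive.sum[OF additive_left] .

text \<open>Countable additivity of \<open>\<mu>\<close> and continuity of \<open>L v\<close> enter
  the proof here; all later convergence statements are derived from this one.\<close>

lemma has_sum_tiles:
  assumes "A \<in> \<SS>" "tiles \<SS> P A"
  shows "((\<lambda>K. L v (\<mu> K)) has_sum L v (\<mu> A)) P"
proof -
  have P: "P \<subseteq> \<SS>" "countable P" "disjoint P" "\<Union>P = A" using assms(2) unfolding tiles_def by auto
  \<comment> \<open>The measure axiom is about families indexed by naturals, so \<open>P\<close> is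
    enumerated and the sum is carried back along the enumeration.\<close>
  define F where "F = inv_into P (to_nat_on P)"
  have inj: "inj_on (to_nat_on P) P" using P(2) by (rule inj_on_to_nat_on)
  have F: "F (to_nat_on P K) = K" if "K \<in> P" for K
    unfolding F_def using that inj by simp
  then have im: "F ` to_nat_on P ` P = P" by (force simp: image_image)
  have "disjoint_family_on F (to_nat_on P ` P)"
    unfolding disjoint_family_on_def using F P(3)
    by (metis (no_types, lifting) disjointD imageE)
  moreover have "A = (\<Union>i\<in>to_nat_on P ` P. F i)" using im P(4) by simp
  ultimately have "((\<lambda>i. \<mu> (F i)) has_sum \<mu> A) (to_nat_on P ` P)"
    using measure assms(1) P(1) im unfolding interval_system_measure_def by metis
  then have "((\<lambda>i. \<mu> (F i)) \<circ> to_nat_on P has_sum \<mu> A) P"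
    using has_sum_reindex[OF inj] by blast
  then have s: "(\<mu> has_sum \<mu> A) P"
    by (rule has_sum_cong[THEN iffD1, rotated]) (simp add: F)
  have "Modules.additive (L v)" using biadditive unfolding biadditive_def by blast
  moreover have "L v \<midarrow>\<mu> A\<rightarrow> L v (\<mu> A)"
    using continuous_right[of v] by (simp add: continuous_on_def)
  ultimately show ?thesis using has_sum_comm_additive[OF _ _ s, of "L v"] by (simp add: o_def)
qed

text \<open>Since \<open>R\<close> decides each \<open>E j\<close>, its tiles inside
  \<open>E j\<close> tile \<open>E j\<close>. The sum for one \<open>j\<close> is extended by zero
  to the whole of \<open>R\<close>, and the finitely many sums are added. The index type is free so
  that a finite set of tiles can also serve as its own index set.\<close>

lemma has_sum_step_fine:
  fixes E :: "'j \<Rightarrow> 'x set"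
  assumes "finite J" "E ` J \<subseteq> \<SS>" "tiles \<SS> R (\<Union>j\<in>J. E j)"
    and dec: "\<And>K j. K \<in> R \<Longrightarrow> j \<in> J \<Longrightarrow> K \<subseteq> E j \<or> K \<inter> E j = {}"
    and val: "\<And>K. K \<in> R \<Longrightarrow> w K = (\<Sum>j\<in>J. if K \<subseteq> E j then c j else 0)"
  shows "((\<lambda>K. L (w K) (\<mu> K)) has_sum (\<Sum>j\<in>J. L (c j) (\<mu> (E j)))) R"
proof -
  have "((\<lambda>K. L (if K \<subseteq> E j then c j else 0) (\<mu> K)) has_sum L (c j) (\<mu> (E j))) R" if j: "j \<in> J" for j
  proof -
    have R: "{} \<notin> R" "\<Union>R = (\<Union>j\<in>J. E j)" using assms(3) unfolding tiles_def by auto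
    have "tiles \<SS> {K\<in>R. K \<subseteq> E j} (\<Union>{K\<in>R. K \<subseteq> E j})"
      by (rule tiles_subset[OF assms(3)]) auto
    moreover have "\<Union>{K\<in>R. K \<subseteq> E j} = E j"
    proof
      show "E j \<subseteq> \<Union>{K\<in>R. K \<subseteq> E j}"
      proof
        fix x assume x: "x \<in> E j"
        then obtain K where "K \<in> R" "x \<in> K" using R j by blast
        then show "x \<in> \<Union>{K\<in>R. K \<subseteq> E j}" using dec[of K j] j x by blast
      qed
    qed blast
    ultimately have "tiles \<SS> {K\<in>R. K \<subseteq> E j} (E j)" by simp
    then have "((\<lambda>K. L (c j) (\<mu> K)) has_sum L (c j) (\<mu> (E j))) {K\<in>R. K \<subseteq> E j}"
      using has_sum_tiles assms(2) j by blast
    then show ?thesis by (rule has_sum_cong_neutral[THEN iffD1, rotated -1]) auto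
  qed
  then have "((\<lambda>K. \<Sum>j\<in>J. L (if K \<subseteq> E j then c j else 0) (\<mu> K)) has_sum
      (\<Sum>j\<in>J. L (c j) (\<mu> (E j)))) R"
    by (intro has_sum_finite_sum[OF assms(1)])
  then show ?thesis
    by (rule has_sum_cong[THEN iffD1, rotated]) (simp add: val L_sum_left)
qed

lemma step_tiles:
  assumes "finite J" "E ` J \<subseteq> \<SS>" "tiles \<SS> P A"
  shows "\<exists>Q. tiles \<SS> Q A \<and> (\<forall>K\<in>Q. \<exists>K'\<in>P. K \<subseteq> K') \<and>
    (\<forall>K\<in>Q. \<forall>j\<in>J. K \<subseteq> E j \<or> K \<inter> E j = {})"
proof -
  have "finite (E ` J)" using assms(1) by simp
  from tileable_decide[OF this assms(2,3)] obtain Q where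
    Q: "tiles \<SS> Q A" "\<forall>K\<in>Q. \<exists>K'\<in>P. K \<subseteq> K'" "\<forall>K\<in>Q. \<forall>E'\<in>E ` J. K \<subseteq> E' \<or> K \<inter> E' = {}"
    by (elim exE conjE)
  then show ?thesis by (intro exI[of _ Q]) simp
qed

text \<open>
  Convergence of iterated sums does not give convergence over the common refinement, so both
  \<open>P\<close> and the sets \<open>E j\<close> are cut into one family \<open>R\<close> on which \<open>has_sum_step_fine\<close> applies, and
  the sum over \<open>R\<close> is then grouped along \<open>P\<close>.
\<close>

lemma has_sum_step:
  assumes J: "finite J" "E ` J \<subseteq> \<SS>" and P: "tiles \<SS> P A"
    and val: "\<And>K x. K \<in> P \<Longrightarrow> x \<in> K \<Longrightarrow> step_sum J c E x = w K"
    and supp: "\<And>x. step_sum J c E x \<noteq> 0 \<Longrightarrow> x \<in> A"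
  shows "((\<lambda>K. L (w K) (\<mu> K)) has_sum (\<Sum>j\<in>J. L (c j) (\<mu> (E j)))) P"
proof -
  let ?s = "step_sum J c E"
  have "countable (E ` J)" using J(1) by (simp add: countable_finite)
  from tileable_Union[OF this J(2)] obtain Q' where "tiles \<SS> Q' (\<Union>j\<in>J. E j)" by blast
  from step_tiles[OF J this] obtain Q where Q: "tiles \<SS> Q (\<Union>j\<in>J. E j)"
    and dec: "\<forall>K\<in>Q. \<forall>j\<in>J. K \<subseteq> E j \<or> K \<inter> E j = {}" by blast
  have Qc: "countable Q" "Q \<subseteq> \<SS>" "\<Union>Q = (\<Union>j\<in>J. E j)" "{} \<notin> Q"
    using Q unfolding tiles_def by auto
  have const: "?s x = ?s y" if "K \<in> Q" "x \<in> K" "y \<in> K" for K x y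
    using step_sum_tile[of x K J E c] step_sum_tile[of y K J E c] dec that by simp
  have zero: "x \<in> \<Union>Q" if "?s x \<noteq> 0" for x
    unfolding Qc using that by (force simp: step_sum_def intro: sum.neutral)
  \<comment> \<open>Tiles of \<open>P\<close> on which the step function vanishes may stick out of
    the sets \<open>E j\<close>, so they cannot be refined by \<open>Q\<close>. They contribute
    nothing and are dropped until the end.\<close>
  define P1 where "P1 = {K\<in>P. w K \<noteq> 0}"
  have Pc: "countable P" "P \<subseteq> \<SS>" "\<Union>P = A" "{} \<notin> P" "disjoint P"
    using P unfolding tiles_def by auto
  have "\<exists>U. tiles \<SS> U K \<and> (\<forall>M\<in>U. \<exists>N\<in>Q. M \<subseteq> N)" if K: "K \<in> P1" for K
  proof (rule tileable_refine[OF _ Qc(1,2)])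
    show "tileable K" using K Pc(2) tiles_self unfolding P1_def by blast
    show "K \<subseteq> \<Union>Q" using K zero val unfolding P1_def by force
  qed
  then obtain U where U: "\<And>K. K \<in> P1 \<Longrightarrow> tiles \<SS> (U K) K"
    and Usub: "\<And>K M. K \<in> P1 \<Longrightarrow> M \<in> U K \<Longrightarrow> \<exists>N\<in>Q. M \<subseteq> N" by metis
  have dis: "disjoint_family_on (\<lambda>K. K) P1"
    using Pc(5) unfolding P1_def disjoint_family_on_def disjoint_def by auto
  have UK: "K' \<subseteq> K" "K' \<noteq> {}" if "K \<in> P1" "K' \<in> U K" for K K'
    using U[OF that(1)] that(2) unfolding tiles_def by auto
  have tU: "tiles \<SS> (\<Union>K\<in>P1. U K) (\<Union>K\<in>P1. K)"
    using Pc(1) U dis by (intro tiles_UN) (auto simp: P1_def)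
  \<comment> \<open>The terms may cancel on parts of the sets \<open>E j\<close>. Those parts must
    be tiled too, since \<open>has_sum_step_fine\<close> asks for a tiling of the whole
    union.\<close>
  define Q0 where "Q0 = {N\<in>Q. \<forall>x\<in>N. ?s x = 0}"
  have tQ0: "tiles \<SS> Q0 (\<Union>Q0)" by (rule tiles_subset[OF Q]) (auto simp: Q0_def)
  have P1nz: "?s x = w K" "w K \<noteq> 0" if "K \<in> P1" "x \<in> K" for K x
    using that val unfolding P1_def by auto
  have "(\<Union>K\<in>P1. K) \<inter> \<Union>Q0 = {}" using P1nz unfolding Q0_def by force
  then have tR: "tiles \<SS> ((\<Union>K\<in>P1. U K) \<union> Q0) ((\<Union>K\<in>P1. K) \<union> \<Union>Q0)"
    using tU tQ0 by (intro tiles_Un)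
  have "(\<Union>K\<in>P1. K) \<union> \<Union>Q0 = (\<Union>j\<in>J. E j)"
  proof
    have "\<Union>P1 \<subseteq> \<Union>Q" using zero P1nz by (metis UnionE subsetI)
    then show "(\<Union>K\<in>P1. K) \<union> \<Union>Q0 \<subseteq> (\<Union>j\<in>J. E j)"
      unfolding Qc(3)[symmetric] Q0_def by blast
    show "(\<Union>j\<in>J. E j) \<subseteq> (\<Union>K\<in>P1. K) \<union> \<Union>Q0"
    proof
      fix x assume "x \<in> (\<Union>j\<in>J. E j)"
      then obtain N where N: "N \<in> Q" "x \<in> N" using Qc(3) by blast
      show "x \<in> (\<Union>K\<in>P1. K) \<union> \<Union>Q0"
      proof (cases "?s x = 0")
        case True
        then have "N \<in> Q0" using const[OF N(1) _ N(2)] N(1) unfolding Q0_def by auto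
        then show ?thesis using N(2) by blast
      next
        case False
        then obtain K where K: "K \<in> P" "x \<in> K" using supp Pc(3) by blast
        then have "K \<in> P1" using val[OF K] False unfolding P1_def by simp
        then show ?thesis using K by blast
      qed
    qed
  qed
  with tR have R: "tiles \<SS> ((\<Union>K\<in>P1. U K) \<union> Q0) (\<Union>j\<in>J. E j)" by simp
  define v where "v M = ?s (SOME x. x \<in> M)" for M
  have sub: "\<exists>N\<in>Q. M \<subseteq> N" if "M \<in> (\<Union>K\<in>P1. U K) \<union> Q0" for M
    using that Usub unfolding Q0_def by blast
  have v: "?s x = v M" if M: "M \<in> (\<Union>K\<in>P1. U K) \<union> Q0" "x \<in> M" for M x
  proof -
    obtain N where "N \<in> Q" "M \<subseteq> N" using sub[OF M(1)] by blast
    moreover have "(SOME x. x \<in> M) \<in> M" using that(2) by (rule someI)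
    ultimately show ?thesis using const[of N x "SOME x. x \<in> M"] that(2) unfolding v_def by blast
  qed
  have "M \<subseteq> E j \<or> M \<inter> E j = {}" if M: "M \<in> (\<Union>K\<in>P1. U K) \<union> Q0" "j \<in> J" for M j
  proof -
    obtain N where "N \<in> Q" "M \<subseteq> N" using sub[OF M(1)] by blast
    then show ?thesis using dec that(2) by blast
  qed
  note dec' = this
  have "v M = (\<Sum>j\<in>J. if M \<subseteq> E j then c j else 0)" if M: "M \<in> (\<Union>K\<in>P1. U K) \<union> Q0" for M
  proof -
    have "M \<noteq> {}" using R M unfolding tiles_def by auto
    then obtain x where x: "x \<in> M" by blast
    show ?thesis using v[OF M x] step_sum_tile[OF x, of J E c] dec'[OF M] by simp
  qed
  from has_sum_step_fine[OF J R dec' this]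
  have "((\<lambda>K. L (v K) (\<mu> K)) has_sum (\<Sum>j\<in>J. L (c j) (\<mu> (E j)))) ((\<Union>K\<in>P1. U K) \<union> Q0)" by simp
  moreover have "v M = 0" if "M \<in> Q0" for M
  proof -
    have "M \<noteq> {}" using that Qc(4) unfolding Q0_def by auto
    then obtain x where "x \<in> M" by blast
    then show ?thesis using that v[of M x] unfolding Q0_def by auto
  qed
  ultimately have "((\<lambda>K. L (v K) (\<mu> K)) has_sum (\<Sum>j\<in>J. L (c j) (\<mu> (E j)))) (\<Union>K\<in>P1. U K)"
    by (elim has_sum_cong_neutral[THEN iffD1, rotated -1]) auto
  \<comment> \<open>Pairing each small tile with the tile of \<open>P1\<close> around it turns the
    sum over small tiles into one over a dependent product, where it can be grouped. The pairing is
    unique because small tiles are nonempty and \<open>P1\<close> is disjoint.\<close>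
  moreover have "snd ` (SIGMA K:P1. U K) = (\<Union>K\<in>P1. U K)" by force
  moreover have inj: "inj_on snd (SIGMA K:P1. U K)"
  proof (rule inj_onI)
    fix p q assume pq: "p \<in> (SIGMA K:P1. U K)" "q \<in> (SIGMA K:P1. U K)" "snd p = snd q"
    then have mem: "fst p \<in> P1" "snd p \<in> U (fst p)" "fst q \<in> P1" "snd p \<in> U (fst q)" by auto
    then have "snd p \<subseteq> fst p \<inter> fst q" "snd p \<noteq> {}"
      using UK(1)[OF mem(1,2)] UK(1)[OF mem(3,4)] UK(2)[OF mem(1,2)] by simp_all
    then have "fst p = fst q"
      using dis mem(1,3) unfolding disjoint_family_on_def by (metis subset_empty)
    then show "p = q" using pq(3) by (simp add: prod_eq_iff)
  qed
  ultimately have "((\<lambda>K. L (v K) (\<mu> K)) \<circ> snd has_sum (\<Sum>j\<in>J. L (c j) (\<mu> (E j)))) (SIGMA K:P1. U K)"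
    using has_sum_reindex[OF inj] by metis
  moreover have "((\<lambda>M. ((\<lambda>K. L (v K) (\<mu> K)) \<circ> snd) (K, M)) has_sum L (w K) (\<mu> K)) (U K)"
    if K: "K \<in> P1" for K
  proof -
    have "K \<in> \<SS>" using K Pc(2) unfolding P1_def by auto
    then have "((\<lambda>M. L (w K) (\<mu> M)) has_sum L (w K) (\<mu> K)) (U K)" using has_sum_tiles U[OF K] by blast
    moreover have "w K = v M" if M: "M \<in> U K" for M
    proof -
      obtain x where x: "x \<in> M" using UK[OF K M] by blast
      have "?s x = w K" using x UK(1)[OF K M] P1nz(1)[OF K] by blast
      then show ?thesis using v[OF _ x] K M by auto
    qed
    ultimately show ?thesis by (elim has_sum_cong[THEN iffD1, rotated]) simp
  qed
  ultimately have "((\<lambda>K. L (w K) (\<mu> K)) has_sum (\<Sum>j\<in>J. L (c j) (\<mu> (E j)))) P1"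
    by (rule has_sum_Sigma')
  then show ?thesis
    by (rule has_sum_cong_neutral[THEN iffD1, rotated -1]) (auto simp: P1_def)
qed

end

section \<open>Neighborhoods of 0 and finite changes of step functions\<close>

text \<open>Three summands, because the longest comparisons below have three errors; shorter ones
  are padded with 0. Two halvings suffice: \<open>a + b\<close> lies in \<open>V\<close>, and so
  does \<open>c\<close>, as \<open>W \<subseteq> V\<close>.\<close>

lemma symmetric_nbhd_three:
  fixes T :: "'z::topological_ab_group_add set"
  assumes "open T" "0 \<in> T"
  obtains U where "open U" "0 \<in> U" "\<And>a. a \<in> U \<Longrightarrow> - a \<in> U"
    "\<And>a b c. a \<in> U \<Longrightarrow> b \<in> U \<Longrightarrow> c \<in> U \<Longrightarrow> a + b + c \<in> T"
proof -
  have half: "\<exists>V. open V \<and> 0 \<in> V \<and> (\<forall>a\<in>V. \<forall>b\<in>V. a + b \<in> S)" if S: "open S" "0 \<in> S" for S :: "'z set"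
  proof -
    have "((\<lambda>p. fst p + snd p) \<longlongrightarrow> 0 + (0::'z)) (nhds 0 \<times>\<^sub>F nhds 0)"
      by (intro tendsto_add filterlim_fst filterlim_snd)
    then have "\<forall>\<^sub>F p in nhds 0 \<times>\<^sub>F nhds 0. fst p + snd p \<in> S"
      using S by (intro topological_tendstoD) auto
    then obtain P where "eventually P (nhds (0::'z))" "\<forall>x y. P x \<longrightarrow> P y \<longrightarrow> x + y \<in> S"
      unfolding eventually_prod_same by auto
    then show ?thesis unfolding eventually_nhds by blast
  qed
  obtain V where V: "open V" "0 \<in> V" "\<forall>a\<in>V. \<forall>b\<in>V. a + b \<in> T" using half[OF assms] by blast
  obtain W where W: "open W" "0 \<in> W" "\<forall>a\<in>W. \<forall>b\<in>W. a + b \<in> V" using half[OF V(1,2)] by blast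
  have "W \<subseteq> V" using W(2,3) by force
  define U where "U = W \<inter> uminus -` W"
  have "open (uminus -` W)" using W(1) by (intro open_vimage continuous_intros)
  then have "open U" "0 \<in> U" "\<And>a. a \<in> U \<Longrightarrow> - a \<in> U" using W(1,2) unfolding U_def by auto
  moreover have "a + b + c \<in> T" if "a \<in> U" "b \<in> U" "c \<in> U" for a b c
    using that V(3) W(3) \<open>W \<subseteq> V\<close> unfolding U_def by blast
  ultimately show ?thesis using that by blast
qed

lemma has_sum_nbhd:
  fixes f :: "'a \<Rightarrow> 'z::topological_ab_group_add"
  assumes "(f has_sum z) A" "open U" "0 \<in> U"
  obtains H where "finite H" "H \<subseteq> A" "\<And>G. finite G \<Longrightarrow> H \<subseteq> G \<Longrightarrow> G \<subseteq> A \<Longrightarrow> z - sum f G \<in> U"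
proof -
  have "open ((\<lambda>y. z - y) -` U)" using assms(2) by (intro open_vimage continuous_intros)
  then have "\<forall>\<^sub>F G in finite_subsets_at_top A. sum f G \<in> (\<lambda>y. z - y) -` U"
    using assms unfolding has_sum_def by (intro topological_tendstoD) auto
  then show ?thesis using that unfolding eventually_finite_subsets_at_top by auto
qed

text \<open>Applied with \<open>K\<close> a singleton, to evaluate a step sum at a point, and with
  \<open>K\<close> a tile, to find the value assigned to it.\<close>

lemma sum_indicator_disjoint:
  fixes u :: "'x set \<Rightarrow> 'v::ab_group_add"
  assumes "finite G" "disjoint G" "M \<in> G" "K \<subseteq> M" "K \<noteq> {}"
  shows "(\<Sum>N\<in>G. if K \<subseteq> N then u N else 0) = u M"
proof -
  have "(\<Sum>N\<in>G. if K \<subseteq> N then u N else 0) = (\<Sum>N\<in>G. if N = M then u N else 0)"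
  proof (rule sum.cong)
    fix N assume "N \<in> G"
    then have "N = M" if "K \<subseteq> N"
      using disjointD[OF assms(2) _ assms(3), of N] assms(4,5) that by blast
    then have "K \<subseteq> N \<longleftrightarrow> N = M" using assms(4) by blast
    then show "(if K \<subseteq> N then u N else 0) = (if N = M then u N else 0)" by simp
  qed simp
  then show ?thesis using assms(1,3) by simp
qed

text \<open>The sets of a step sum may overlap, so a correction is simply appended under a fresh
  index. Function and integral are followed together, with \<open>l\<close> standing for the pairing
  with the measure.\<close>

lemma step_sum_add_finite:
  fixes c :: "nat \<Rightarrow> 'v::ab_group_add" and l :: "'v \<Rightarrow> 'x set \<Rightarrow> 'z::ab_group_add"
  assumes "finite G" "G \<subseteq> \<SS>" "finite J" "E ` J \<subseteq> \<SS>"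
  shows "\<exists>J' c' E'. finite J' \<and> E' ` J' \<subseteq> \<SS> \<and>
    (\<forall>x. step_sum J' c' E' x = step_sum J c E x + (\<Sum>K\<in>G. if x \<in> K then u K else 0)) \<and>
    (\<Sum>j\<in>J'. l (c' j) (E' j)) = (\<Sum>j\<in>J. l (c j) (E j)) + (\<Sum>K\<in>G. l (u K) K)"
  using assms(1,2)
proof (induction G)
  case empty
  show ?case by (rule exI[of _ J], rule exI[of _ c], rule exI[of _ E]) (use assms in auto)
next
  case (insert M G)
  have "G \<subseteq> \<SS>" using insert.prems by simp
  from insert.IH[OF this] obtain J' c' E' where IH: "finite J'" "E' ` J' \<subseteq> \<SS>"
    "\<forall>x. step_sum J' c' E' x = step_sum J c E x + (\<Sum>K\<in>G. if x \<in> K then u K else 0)"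
    "(\<Sum>j\<in>J'. l (c' j) (E' j)) = (\<Sum>j\<in>J. l (c j) (E j)) + (\<Sum>K\<in>G. l (u K) K)"
    by (elim exE conjE)
  obtain n where n: "n \<notin> J'" using IH(1) ex_new_if_finite infinite_UNIV_nat by blast
  define c2 where "c2 = c'(n := u M)"
  define E2 where "E2 = E'(n := M)"
  have same: "c2 j = c' j" "E2 j = E' j" if "j \<in> J'" for j
    using that n unfolding c2_def E2_def by auto
  have "finite (insert n J')" "E2 ` insert n J' \<subseteq> \<SS>"
    using IH(1,2) insert.prems same unfolding E2_def by auto
  moreover have "step_sum (insert n J') c2 E2 x =
      step_sum J c E x + (\<Sum>K\<in>insert M G. if x \<in> K then u K else 0)" for x
  proof -
    have "step_sum (insert n J') c2 E2 x = (if x \<in> M then u M else 0) + step_sum J' c2 E2 x"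
      unfolding step_sum_def using IH(1) n by (simp add: c2_def E2_def)
    also have "step_sum J' c2 E2 x = step_sum J' c' E' x"
      unfolding step_sum_def by (rule sum.cong) (auto simp: same)
    finally show ?thesis using IH(3) insert.hyps by (simp add: algebra_simps)
  qed
  moreover have "(\<Sum>j\<in>insert n J'. l (c2 j) (E2 j)) =
      (\<Sum>j\<in>J. l (c j) (E j)) + (\<Sum>K\<in>insert M G. l (u K) K)"
  proof -
    have "(\<Sum>j\<in>J'. l (c2 j) (E2 j)) = (\<Sum>j\<in>J'. l (c' j) (E' j))"
      by (rule sum.cong) (auto simp: same)
    then show ?thesis using IH(1,4) n insert.hyps by (simp add: c2_def E2_def algebra_simps)
  qed
  ultimately show ?case
    by (intro exI[of _ "insert n J'"] exI[of _ c2] exI[of _ E2]) simp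
qed

section \<open>Changing a step function inside an envelope\<close>

context measure_pairing
begin

definition step_integrals :: "('v \<times> 'x) set \<Rightarrow> 'z set" where
  "step_integrals \<A> = {\<Sum>j\<in>J. L (c j) (\<mu> (E j)) | J c E.
     finite J \<and> E ` J \<subseteq> \<SS> \<and> value_graph X (step_sum J c E) \<subseteq> \<A>}"

text \<open>
  Given a finite \<open>F \<subseteq> \<C>\<close>, the step function is changed to \<open>v\<close> on finitely many pieces of \<open>\<Union>F\<close> and
  to 0 on finitely many pieces of \<open>\<B>\<close>, which keeps its graph inside \<open>\<A>\<close>. What remains lies on tiles
  inside sets of \<open>\<C> - F\<close>. These tiles belong to \<open>P\<close>, which does not depend on \<open>F\<close>, so their
  contribution is small as soon as \<open>F\<close> accounts for the finite part \<open>P0\<close> of \<open>P\<close>. The set \<open>\<Union>\<C>\<close> cannot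
  be removed from \<open>\<Union>\<B>\<close> beforehand: the difference need not be tileable when \<open>\<C>\<close> is infinite.
\<close>

lemma step_integral_near_sum:
  assumes T: "open T" "0 \<in> T"
    and J: "finite J" "E ` J \<subseteq> \<SS>" and graph: "value_graph X (step_sum J c E) \<subseteq> \<A>"
    and C: "tiles \<SS> \<C> (\<Union>\<C>)" and vC: "\<And>K x. K \<in> \<C> \<Longrightarrow> x \<in> K \<Longrightarrow> (v K, x) \<in> \<A>"
    and B: "countable \<B>" "\<B> \<subseteq> \<SS>" and zB: "\<And>K x. K \<in> \<B> \<Longrightarrow> x \<in> K \<Longrightarrow> (0, x) \<in> \<A>"
    and supp: "\<And>x. step_sum J c E x \<noteq> 0 \<Longrightarrow> x \<in> \<Union>\<C> \<union> \<Union>\<B>"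
  shows "\<exists>F0\<subseteq>\<C>. finite F0 \<and> (\<forall>F. finite F \<longrightarrow> F0 \<subseteq> F \<longrightarrow> F \<subseteq> \<C> \<longrightarrow>
    (\<exists>p\<in>step_integrals \<A>. p - (\<Sum>K\<in>F. L (v K) (\<mu> K)) \<in> T))"
proof -
  let ?s = "step_sum J c E"
  let ?D = "\<Union>\<C> \<union> \<Union>\<B>"
  let ?z = "\<Sum>j\<in>J. L (c j) (\<mu> (E j))"
  define w where "w K = ?s (SOME x. x \<in> K)" for K
  define g where "g K = L (w K) (\<mu> K)" for K
  have w: "?s x = w K" if K: "\<forall>j\<in>J. K \<subseteq> E j \<or> K \<inter> E j = {}" "x \<in> K" for K x
  proof -
    have "(SOME x. x \<in> K) \<in> K" using K(2) by (rule someI)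
    then show ?thesis
      unfolding w_def using step_sum_tile[of _ K J E c] K by simp
  qed
  have Cc: "countable \<C>" "\<C> \<subseteq> \<SS>" "disjoint \<C>" "{} \<notin> \<C>" using C unfolding tiles_def by auto
  have "countable (\<C> \<union> \<B>)" "\<C> \<union> \<B> \<subseteq> \<SS>" using Cc B by auto
  from tileable_Union[OF this] obtain P' where P': "tiles \<SS> P' ?D" "\<forall>K\<in>P'. \<exists>Q\<in>\<C> \<union> \<B>. K \<subseteq> Q"
    by auto
  from step_tiles[OF J P'(1)] obtain P where P: "tiles \<SS> P ?D"
    and Psub': "\<forall>K\<in>P. \<exists>K'\<in>P'. K \<subseteq> K'"
    and Pdec: "\<forall>K\<in>P. \<forall>j\<in>J. K \<subseteq> E j \<or> K \<inter> E j = {}" by (elim exE conjE)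
  have Psub: "\<exists>Q\<in>\<C> \<union> \<B>. K \<subseteq> Q" if "K \<in> P" for K
    using Psub' P'(2) that by (meson subset_trans)
  have Pc: "P \<subseteq> \<SS>" "disjoint P" "{} \<notin> P" "\<Union>P = ?D" "countable P"
    using P unfolding tiles_def by auto
  obtain U where U: "open U" "0 \<in> U" "\<And>a. a \<in> U \<Longrightarrow> - a \<in> U"
    "\<And>a b c. a \<in> U \<Longrightarrow> b \<in> U \<Longrightarrow> c \<in> U \<Longrightarrow> a + b + c \<in> T"
    by (rule symmetric_nbhd_three[OF T], rule that)
  \<comment> \<open>Each of the three final errors must lie in \<open>U\<close>. One of them is a
    tail, the difference of two errors of partial sums over \<open>P\<close>, which is why these are
    kept in the smaller \<open>U'\<close>.\<close>
  obtain U' where U': "open U'" "0 \<in> U'" "\<And>a. a \<in> U' \<Longrightarrow> - a \<in> U'"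
    "\<And>a b c. a \<in> U' \<Longrightarrow> b \<in> U' \<Longrightarrow> c \<in> U' \<Longrightarrow> a + b + c \<in> U"
    by (rule symmetric_nbhd_three[OF U(1,2)], rule that)
  have "(g has_sum ?z) P"
    unfolding g_def using Pdec by (intro has_sum_step[OF J P] w supp) auto
  note sum_P = this
  obtain P0 where P0: "finite P0" "P0 \<subseteq> P"
    "\<And>G. finite G \<Longrightarrow> P0 \<subseteq> G \<Longrightarrow> G \<subseteq> P \<Longrightarrow> ?z - sum g G \<in> U'"
    by (rule has_sum_nbhd[OF sum_P U'(1,2)], rule that)
  \<comment> \<open>The Cauchy criterion: adding \<open>G\<close> to \<open>P0\<close> moves the
    partial sum from one point near \<open>?z\<close> to another.\<close>
  have small: "sum g G \<in> U" if G: "finite G" "G \<subseteq> P" "G \<inter> P0 = {}" for G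
  proof -
    have "?z - sum g P0 \<in> U'" "?z - sum g (P0 \<union> G) \<in> U'" using P0 G(1,2) by auto
    then have "(?z - sum g P0) + - (?z - sum g (P0 \<union> G)) + 0 \<in> U"
      by (intro U'(2-4))
    moreover have "sum g (P0 \<union> G) = sum g P0 + sum g G"
      using P0(1) G by (intro sum.union_disjoint) auto
    ultimately show ?thesis by simp
  qed
  define h where "h K = (SOME M. M \<in> \<C> \<and> K \<subseteq> M)" for K
  have h: "h K = M" if "K \<in> P" "M \<in> \<C>" "K \<subseteq> M" for K M
  proof -
    have "h K \<in> \<C> \<and> K \<subseteq> h K" unfolding h_def by (rule someI[of _ M]) (use that(2,3) in simp)
    moreover have "K \<noteq> {}" using that(1) Pc(3) by auto
    ultimately show ?thesis using disjointD[OF Cc(3) _ that(2), of "h K"] that(3) by blast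
  qed
  \<comment> \<open>These are the sets of \<open>\<C>\<close> that contain a tile of
    \<open>P0\<close>. Once \<open>F\<close> includes them, no tile inside a set of
    \<open>\<C> - F\<close> belongs to \<open>P0\<close>.\<close>
  define F0 where "F0 = h ` {K\<in>P0. \<exists>M\<in>\<C>. K \<subseteq> M}"
  have "finite F0" unfolding F0_def using P0(1) by simp
  moreover have "F0 \<subseteq> \<C>"
  proof
    fix M assume "M \<in> F0"
    then obtain K M' where "K \<in> P0" "M = h K" "M' \<in> \<C>" "K \<subseteq> M'" unfolding F0_def by blast
    then show "M \<in> \<C>" using h[of K M'] P0(2) by auto
  qed
  moreover have "\<exists>p\<in>step_integrals \<A>. p - (\<Sum>K\<in>F. L (v K) (\<mu> K)) \<in> T"
    if F: "finite F" "F0 \<subseteq> F" "F \<subseteq> \<C>" for F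
  proof -
    have tF: "tiles \<SS> F (\<Union>F)" using tiles_subset[OF C F(3)] .
    have Fs: "F \<subseteq> \<SS>" "disjoint F" using tF unfolding tiles_def by auto
    from step_tiles[OF J tF] obtain R1 where R1: "tiles \<SS> R1 (\<Union>F)" "\<forall>K\<in>R1. \<exists>M\<in>F. K \<subseteq> M"
      "\<forall>K\<in>R1. \<forall>j\<in>J. K \<subseteq> E j \<or> K \<inter> E j = {}" by (elim exE conjE)
    \<comment> \<open>A tile of \<open>P\<close> inside no set of \<open>\<C>\<close> lies inside a
      set of \<open>\<B>\<close>, so 0 is admissible on it. It may still meet
      \<open>\<Union>F\<close>, where the value is to become \<open>v\<close>; as \<open>F\<close>
      is finite, that part can be cut off.\<close>
    define N where "N = \<Union>{K\<in>P. \<forall>M\<in>\<C>. \<not> K \<subseteq> M} - \<Union>F"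
    have "tiles \<SS> {K\<in>P. \<forall>M\<in>\<C>. \<not> K \<subseteq> M} (\<Union>{K\<in>P. \<forall>M\<in>\<C>. \<not> K \<subseteq> M})"
      by (rule tiles_subset[OF P]) blast
    then have "tileable N" unfolding N_def by (intro tileable_Diff_finite[OF F(1) Fs(1)] exI)
    then obtain R2' where "tiles \<SS> R2' N" by (elim exE)
    from step_tiles[OF J this] obtain R2 where R2: "tiles \<SS> R2 N"
      "\<forall>K\<in>R2. \<forall>j\<in>J. K \<subseteq> E j \<or> K \<inter> E j = {}" by (elim exE conjE)
    define R3 where "R3 = {K\<in>P. \<exists>M\<in>\<C> - F. K \<subseteq> M}"
    have tR3: "tiles \<SS> R3 (\<Union>R3)" by (rule tiles_subset[OF P]) (auto simp: R3_def)
    have R3N: "\<Union>R3 \<inter> N = {}"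
    proof -
      have "K \<inter> K' = {}" if "K \<in> R3" "K' \<in> P" "\<forall>M\<in>\<C>. \<not> K' \<subseteq> M" for K K'
        using disjointD[OF Pc(2), of K K'] that unfolding R3_def by blast
      then show ?thesis unfolding N_def by blast
    qed
    have R3F: "\<Union>R3 \<inter> \<Union>F = {}"
    proof -
      have "M \<inter> M' = {}" if "M \<in> \<C> - F" "M' \<in> F" for M M'
        using disjointD[OF Cc(3), of M M'] that F(3) by blast
      then show ?thesis unfolding R3_def by blast
    qed
    have R3P0: "R3 \<inter> P0 = {}"
    proof -
      have False if K: "K \<in> R3" "K \<in> P0" for K
      proof -
        obtain M where M: "M \<in> \<C> - F" "K \<subseteq> M" "K \<in> P" using K(1) unfolding R3_def by blast
        then have "h K \<in> F0" using K(2) unfolding F0_def by blast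
        then show False using h[of K M] M F(2) by auto
      qed
      then show ?thesis by blast
    qed
    have "tiles \<SS> (R1 \<union> R2) (\<Union>F \<union> N)" by (rule tiles_Un[OF R1(1) R2(1)]) (auto simp: N_def)
    then have tR: "tiles \<SS> (R1 \<union> R2 \<union> R3) (\<Union>F \<union> N \<union> \<Union>R3)"
      by (rule tiles_Un[OF _ tR3]) (use R3N R3F in blast)
    have cover: "x \<in> \<Union>F \<union> N \<union> \<Union>R3" if "x \<in> ?D" for x
    proof -
      obtain K where K: "K \<in> P" "x \<in> K" using \<open>x \<in> ?D\<close> Pc(4) by blast
      show ?thesis
      proof (cases "x \<in> \<Union>F")
        case False
        show ?thesis
        proof (cases "\<exists>M\<in>\<C>. K \<subseteq> M")
          case True
          then obtain M where M: "M \<in> \<C>" "K \<subseteq> M" by blast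
          then have "M \<notin> F" using False K(2) by blast
          then have "K \<in> R3" using M K(1) unfolding R3_def by blast
          then show ?thesis using K(2) by blast
        next
          case nsub: False
          then have "x \<in> N" using K False unfolding N_def by blast
          then show ?thesis by blast
        qed
      qed blast
    qed
    have Rdec: "\<forall>j\<in>J. K \<subseteq> E j \<or> K \<inter> E j = {}" if "K \<in> R1 \<union> R2 \<union> R3" for K
    proof -
      consider "K \<in> R1" | "K \<in> R2" | "K \<in> P" using \<open>K \<in> R1 \<union> R2 \<union> R3\<close> unfolding R3_def by blast
      then show ?thesis using R1(3) R2(2) Pdec by cases simp_all
    qed
    have "(g has_sum ?z) (R1 \<union> R2 \<union> R3)"
      unfolding g_def by (rule has_sum_step[OF J tR]) (use w Rdec supp cover in \<open>simp; fail\<close>)+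
    note sum_R = this
  obtain H where H: "finite H" "H \<subseteq> R1 \<union> R2 \<union> R3"
      "\<And>G. finite G \<Longrightarrow> H \<subseteq> G \<Longrightarrow> G \<subseteq> R1 \<union> R2 \<union> R3 \<Longrightarrow> ?z - sum g G \<in> U"
      by (rule has_sum_nbhd[OF sum_R U(1,2)], rule that)
    define vv where "vv K = (\<Sum>M\<in>F. if K \<subseteq> M then v M else 0)" for K
    have R1F: "K \<subseteq> M \<or> K \<inter> M = {}" if K: "K \<in> R1" "M \<in> F" for K M
    proof -
      obtain M' where "M' \<in> F" "K \<subseteq> M'" using R1(2) K(1) by blast
      then show ?thesis using disjointD[OF Fs(2), of M M'] K(2) by blast
    qed
    have "((\<lambda>K. L (vv K) (\<mu> K)) has_sum (\<Sum>M\<in>F. L (v M) (\<mu> M))) R1"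
    proof (rule has_sum_step_fine[where E = "\<lambda>M. M"])
      show "tiles \<SS> R1 (\<Union>M\<in>F. M)" using R1(1) by simp
    qed (use F(1) Fs(1) R1F vv_def in auto)
    note sum_R1 = this
    obtain H' where H': "finite H'" "H' \<subseteq> R1"
      "\<And>G. finite G \<Longrightarrow> H' \<subseteq> G \<Longrightarrow> G \<subseteq> R1 \<Longrightarrow>
        (\<Sum>M\<in>F. L (v M) (\<mu> M)) - (\<Sum>K\<in>G. L (vv K) (\<mu> K)) \<in> U"
      by (rule has_sum_nbhd[OF sum_R1 U(1,2)], rule that)
    \<comment> \<open>\<open>G1\<close> serves two approximations: together with \<open>G2\<close>
      and \<open>G3\<close> it must contain \<open>H\<close>, for the original integral, and it must
      contain \<open>H'\<close>, for the sum over \<open>F\<close>.\<close>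
    define G1 G2 G3 where "G1 = (H \<inter> R1) \<union> H'" and "G2 = H \<inter> R2" and "G3 = H \<inter> R3"
    have fin: "finite G1" "finite G2" "finite G3" unfolding G1_def G2_def G3_def using H(1) H'(1) by auto
    have sub: "G1 \<subseteq> R1" "G2 \<subseteq> R2" "G3 \<subseteq> R3" unfolding G1_def G2_def G3_def using H'(2) by auto
    have ne: "{} \<notin> R1 \<union> R2 \<union> R3" using tR unfolding tiles_def by auto
    have sets: "\<Union>R1 = \<Union>F" "\<Union>R2 = N" using R1(1) R2(1) unfolding tiles_def by auto
    have NF: "N \<inter> \<Union>F = {}" unfolding N_def by blast
    have apart: "G \<inter> G' = {}" if "G \<subseteq> R1 \<union> R2 \<union> R3" "\<Union>G \<inter> \<Union>G' = {}" for G G'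
    proof -
      have "{} \<notin> G" using that(1) ne by blast
      then show ?thesis using that(2) by (metis Int_emptyI Union_upper disjoint_iff ex_in_conv subsetD)
    qed
    have Usub: "\<Union>G1 \<subseteq> \<Union>F" "\<Union>G2 \<subseteq> N" "\<Union>G3 \<subseteq> \<Union>R3"
      using Union_mono[OF sub(1)] Union_mono[OF sub(2)] Union_mono[OF sub(3)] sets by simp_all
    have Rsub: "R1 \<subseteq> R1 \<union> R2 \<union> R3" "G1 \<union> G2 \<subseteq> R1 \<union> R2 \<union> R3"
      using sub by auto
    have R12: "R1 \<inter> R2 = {}"
      by (rule apart[OF Rsub(1)]) (simp add: sets NF Int_commute)
    have d12: "G1 \<inter> R2 = {}" using R12 sub(1) by blast
    have d123: "(G1 \<union> G2) \<inter> G3 = {}"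
    proof (rule apart[OF Rsub(2)])
      have "\<Union>(G1 \<union> G2) \<subseteq> \<Union>F \<union> N" using Usub(1,2) by blast
      then show "\<Union>(G1 \<union> G2) \<inter> \<Union>G3 = {}" using Usub(3) R3N R3F by blast
    qed
    \<comment> \<open>Adding \<open>u\<close> replaces the value \<open>w K\<close> by
      \<open>vv K\<close> on tiles of \<open>G1\<close> and by 0 on tiles of \<open>G2\<close>.
      Everywhere else the function keeps its admissible value.\<close>
    define u where "u K = (if K \<in> R1 then vv K - w K else - w K)" for K
    have G12: "finite (G1 \<union> G2)" "G1 \<union> G2 \<subseteq> \<SS>" "disjoint (G1 \<union> G2)" "{} \<notin> G1 \<union> G2"
    proof -
      from tiles_subset[OF tR Rsub(2)]
      show "G1 \<union> G2 \<subseteq> \<SS>" "disjoint (G1 \<union> G2)" "{} \<notin> G1 \<union> G2" unfolding tiles_def by simp_all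
      show "finite (G1 \<union> G2)" using fin by simp
    qed
    from step_sum_add_finite[OF G12(1,2) J, of c u "\<lambda>a K. L a (\<mu> K)"]
    obtain J' c' E' where J': "finite J'" "E' ` J' \<subseteq> \<SS>"
      and st: "\<forall>x. step_sum J' c' E' x = ?s x + (\<Sum>K\<in>G1 \<union> G2. if x \<in> K then u K else 0)"
      and sv: "(\<Sum>j\<in>J'. L (c' j) (\<mu> (E' j))) = ?z + (\<Sum>K\<in>G1 \<union> G2. L (u K) (\<mu> K))"
      by (elim exE conjE)
    have "(step_sum J' c' E' x, x) \<in> \<A>" if x: "x \<in> X" for x
    proof (cases "\<exists>K\<in>G1 \<union> G2. x \<in> K")
      case True
      then obtain K where K: "K \<in> G1 \<union> G2" "x \<in> K" by blast
      have "(\<Sum>M\<in>G1 \<union> G2. if x \<in> M then u M else 0) = u K"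
        using sum_indicator_disjoint[OF G12(1,3) K(1), of "{x}" u] K(2) by simp
      moreover have "?s x = w K" by (rule w[OF Rdec K(2)]) (use K(1) Rsub(2) in blast)
      ultimately have t: "step_sum J' c' E' x = w K + u K" using st by simp
      show ?thesis
      proof (cases "K \<in> R1")
        case True
        then obtain M where M: "M \<in> F" "K \<subseteq> M" using R1(2) by blast
        have "vv K = v M" unfolding vv_def
          by (rule sum_indicator_disjoint[OF F(1) Fs(2) M]) (use K(2) in blast)
        then have "step_sum J' c' E' x = v M" using t True unfolding u_def by simp
        then show ?thesis using vC[of M x] M F(3) K(2) by auto
      next
        case False
        then have "step_sum J' c' E' x = 0" "K \<in> R2" using t K(1) sub unfolding u_def by auto
        then have "x \<in> N" using sets(2) K(2) by blast
        then obtain K' where K': "K' \<in> P" "\<forall>M\<in>\<C>. \<not> K' \<subseteq> M" "x \<in> K'" unfolding N_def by blast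
        then obtain Q where "Q \<in> \<B>" "K' \<subseteq> Q" using Psub[of K'] by blast
        then have "(0, x) \<in> \<A>" using zB[of Q x] K'(3) by blast
        then show ?thesis using \<open>step_sum J' c' E' x = 0\<close> by simp
      qed
    next
      case False
      then have "(\<Sum>M\<in>G1 \<union> G2. if x \<in> M then u M else 0) = 0" by (intro sum.neutral) auto
      then show ?thesis using st graph x unfolding value_graph_def by auto
    qed
    then have "value_graph X (step_sum J' c' E') \<subseteq> \<A>" unfolding value_graph_def by blast
    then have p: "(\<Sum>j\<in>J'. L (c' j) (\<mu> (E' j))) \<in> step_integrals \<A>"
      unfolding step_integrals_def using J' by blast
    have "(\<Sum>K\<in>G1 \<union> G2. L (u K) (\<mu> K)) = (\<Sum>K\<in>G1. L (u K) (\<mu> K)) + (\<Sum>K\<in>G2. L (u K) (\<mu> K))"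
      using fin d12 sub(2) by (intro sum.union_disjoint) blast+
    also have "(\<Sum>K\<in>G1. L (u K) (\<mu> K)) = (\<Sum>K\<in>G1. L (vv K) (\<mu> K) - g K)"
      using sub(1) by (intro sum.cong) (auto simp: u_def g_def L_diff_left)
    also have "\<dots> = (\<Sum>K\<in>G1. L (vv K) (\<mu> K)) - sum g G1" by (rule sum_subtractf)
    also have "(\<Sum>K\<in>G2. L (u K) (\<mu> K)) = (\<Sum>K\<in>G2. - g K)"
    proof (rule sum.cong)
      fix K assume "K \<in> G2"
      then have "K \<notin> R1" using sub(2) R12 by blast
      then show "L (u K) (\<mu> K) = - g K"
        using L_diff_left[of 0 "w K" "\<mu> K"] by (simp add: u_def g_def)
    qed simp
    also have "\<dots> = - sum g G2" by (rule sum_negf)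
    finally have su: "(\<Sum>K\<in>G1 \<union> G2. L (u K) (\<mu> K)) =
      (\<Sum>K\<in>G1. L (vv K) (\<mu> K)) - sum g G1 + - sum g G2" .
    have sg: "sum g (G1 \<union> G2 \<union> G3) = sum g G1 + sum g G2 + sum g G3"
    proof -
      have "sum g (G1 \<union> G2 \<union> G3) = sum g (G1 \<union> G2) + sum g G3"
        using fin d123 by (intro sum.union_disjoint) auto
      also have "sum g (G1 \<union> G2) = sum g G1 + sum g G2"
        using fin d12 sub(2) by (intro sum.union_disjoint) blast+
      finally show ?thesis .
    qed
    \<comment> \<open>The new integral differs from the sum over \<open>F\<close> by three errors:
      that of the partial sum for \<open>?z\<close>, the part over \<open>G3\<close> which was left
      unchanged, and that of the partial sum over \<open>G1\<close> for the sum over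
      \<open>F\<close>.\<close>
    have "?z - sum g (G1 \<union> G2 \<union> G3) \<in> U"
    proof (rule H(3))
      show "H \<subseteq> G1 \<union> G2 \<union> G3" using H(2) unfolding G1_def G2_def G3_def by blast
      show "G1 \<union> G2 \<union> G3 \<subseteq> R1 \<union> R2 \<union> R3" using sub by blast
    qed (use fin in simp)
    moreover have "sum g G3 \<in> U"
      by (rule small[OF fin(3)]) (use sub(3) R3P0 in \<open>auto simp: R3_def\<close>)
    moreover have "- ((\<Sum>M\<in>F. L (v M) (\<mu> M)) - (\<Sum>K\<in>G1. L (vv K) (\<mu> K))) \<in> U"
      by (intro U(3) H'(3) fin sub) (simp add: G1_def)
    ultimately have "(?z - sum g (G1 \<union> G2 \<union> G3)) + sum g G3 +
      - ((\<Sum>M\<in>F. L (v M) (\<mu> M)) - (\<Sum>K\<in>G1. L (vv K) (\<mu> K))) \<in> T"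
      by (rule U(4))
    moreover have "(?z - sum g (G1 \<union> G2 \<union> G3)) + sum g G3 +
      - ((\<Sum>M\<in>F. L (v M) (\<mu> M)) - (\<Sum>K\<in>G1. L (vv K) (\<mu> K))) =
      (\<Sum>j\<in>J'. L (c' j) (\<mu> (E' j))) - (\<Sum>M\<in>F. L (v M) (\<mu> M))"
      unfolding sv su sg by (simp add: algebra_simps)
    ultimately have "(\<Sum>j\<in>J'. L (c' j) (\<mu> (E' j))) - (\<Sum>M\<in>F. L (v M) (\<mu> M)) \<in> T"
      by metis
    then show ?thesis using p by (rule bexI)
  qed
  ultimately show ?thesis by (intro exI[of _ F0]) blast
qed

end

section \<open>Convergence of Cauchy nets indexed by neighborhoods of 0\<close>

definition open_nbhd :: "'z::{topological_space, zero} set \<Rightarrow> bool" where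
  "open_nbhd V \<longleftrightarrow> open V \<and> 0 \<in> V"

lemma open_nbhd_Int: "open_nbhd U \<Longrightarrow> open_nbhd V \<Longrightarrow> open_nbhd (U \<inter> V)"
  unfolding open_nbhd_def by auto

text \<open>The net is ordered by reverse inclusion. Its tails generate the filter \<open>G\<close>,
  where intersections of neighborhoods give the filter base; \<open>G\<close> is Cauchy, so
  completeness supplies a limit.\<close>

lemma cauchy_net_nbhds_converges:
  fixes p :: "'z set \<Rightarrow> 'z::{topological_ab_group_add, uniform_topological_group_add, complete_uniform_space}"
  assumes close: "\<And>T. open_nbhd T \<Longrightarrow> \<exists>U. open_nbhd U \<and>
    (\<forall>V W. open_nbhd V \<longrightarrow> V \<subseteq> U \<longrightarrow> open_nbhd W \<longrightarrow> W \<subseteq> U \<longrightarrow> p W - p V \<in> T)"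
  shows "\<exists>a. \<forall>U. open_nbhd U \<longrightarrow> (\<exists>W. open_nbhd W \<and> (\<forall>V. open_nbhd V \<longrightarrow> V \<subseteq> W \<longrightarrow> p V - a \<in> U))"
proof -
  define G where "G = (INF U\<in>Collect open_nbhd. principal (p ` {V. open_nbhd V \<and> V \<subseteq> U}))"
  have evG: "eventually Q G \<longleftrightarrow> (\<exists>U. open_nbhd U \<and> (\<forall>V. open_nbhd V \<longrightarrow> V \<subseteq> U \<longrightarrow> Q (p V)))" for Q
  proof -
    have "eventually Q G \<longleftrightarrow>
        (\<exists>U\<in>Collect open_nbhd. eventually Q (principal (p ` {V. open_nbhd V \<and> V \<subseteq> U})))"
      unfolding G_def
    proof (rule eventually_INF_base)
      have "open_nbhd (UNIV :: 'z set)" by (simp add: open_nbhd_def)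
      then show "Collect open_nbhd \<noteq> ({} :: 'z set set)" by blast
      show "\<exists>W\<in>Collect open_nbhd. principal (p ` {V. open_nbhd V \<and> V \<subseteq> W}) \<le>
          inf (principal (p ` {V. open_nbhd V \<and> V \<subseteq> U})) (principal (p ` {V. open_nbhd V \<and> V \<subseteq> U'}))"
        if "U \<in> Collect open_nbhd" "U' \<in> Collect open_nbhd" for U U'
        by (rule bexI[of _ "U \<inter> U'"]) (use that in \<open>auto intro: open_nbhd_Int\<close>)
    qed
    then show ?thesis by (simp add: eventually_principal imp_conjL)
  qed
  have "G \<noteq> bot"
  proof
    assume "G = bot"
    then have "eventually (\<lambda>_. False) G" by simp
    then obtain U :: "'z set" where "open_nbhd U" "\<forall>V. open_nbhd V \<longrightarrow> \<not> V \<subseteq> U" unfolding evG by auto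
    then show False by blast
  qed
  moreover have "cauchy_filter G"
    unfolding cauchy_filter_def
  proof (rule filter_leI)
    fix Q :: "'z \<times> 'z \<Rightarrow> bool" assume "eventually Q uniformity"
    \<comment> \<open>The rewriting identifies the uniformity with the pullback of
      \<open>nhds 0\<close> under \<open>y - x\<close>, so closeness of pairs becomes membership of
      differences in a neighborhood.\<close>
    then obtain R where R: "eventually R (nhds 0)" "\<forall>xy. R (case xy of (x, y) \<Rightarrow> y - x) \<longrightarrow> Q xy"
      unfolding cauchy_seq_finset_iff_vanishing eventually_filtercomap by (elim exE conjE)
    obtain T where T: "open T" "0 \<in> T" "\<forall>t\<in>T. R t"
      using R(1) unfolding eventually_nhds by (elim exE conjE)
    then have "open_nbhd T" by (simp add: open_nbhd_def)
    from close[OF this] obtain U where U: "open_nbhd U"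
      "\<forall>V W. open_nbhd V \<longrightarrow> V \<subseteq> U \<longrightarrow> open_nbhd W \<longrightarrow> W \<subseteq> U \<longrightarrow> p W - p V \<in> T"
      by (elim exE conjE)
    have Q: "Q (x, y)" if "x \<in> p ` {V. open_nbhd V \<and> V \<subseteq> U}" "y \<in> p ` {V. open_nbhd V \<and> V \<subseteq> U}" for x y
    proof -
      have "y - x \<in> T" using that U(2) by auto
      then show ?thesis using T(3) R(2)[rule_format, of "(x, y)"] by simp
    qed
    have "eventually (\<lambda>x. x \<in> p ` {V. open_nbhd V \<and> V \<subseteq> U}) G"
      unfolding evG using U(1) by (intro exI[of _ U]) simp
    then show "eventually Q (G \<times>\<^sub>F G)"
      unfolding eventually_prod_same
      by (intro exI[of _ "\<lambda>x. x \<in> p ` {V. open_nbhd V \<and> V \<subseteq> U}"]) (intro conjI allI impI Q; assumption)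
  qed
  ultimately obtain a where a: "G \<le> nhds a"
    using cauchy_filter_convergent[of G] by (auto simp: convergent_filter_iff)
  have "\<exists>W. open_nbhd W \<and> (\<forall>V. open_nbhd V \<longrightarrow> V \<subseteq> W \<longrightarrow> p V - a \<in> U)" if U: "open_nbhd U" for U
  proof -
    have "open ((\<lambda>y. y - a) -` U)"
      using U unfolding open_nbhd_def by (intro open_vimage continuous_intros) simp
    then have "eventually (\<lambda>y. y \<in> (\<lambda>y. y - a) -` U) (nhds a)"
      using U unfolding open_nbhd_def by (intro eventually_nhds_in_open) simp_all
    then have "eventually (\<lambda>y. y - a \<in> U) G" using filter_leD[OF a] by simp
    then show ?thesis unfolding evG .
  qed
  then show ?thesis by blast
qed

section \<open>Comparison of two envelopes of one function\<close>

context measure_pairing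
begin

lemma bilinear_sum_eq: "bilinear_sum X \<SS> L \<mu> \<A> = closure (step_integrals \<A>)"
  unfolding bilinear_sum_def step_integrals_def ..

lemma step_integrals_subset: "step_integrals \<A> \<subseteq> bilinear_sum X \<SS> L \<mu> \<A>"
  unfolding bilinear_sum_eq by (rule closure_subset)

lemma envelope_step:
  assumes "envelope X \<SS> \<A>"
  obtains J c E where "finite J" "E ` J \<subseteq> \<SS>" "value_graph X (step_sum J c E) \<subseteq> \<A>"
proof -
  have "\<exists>s. step_function X \<SS> s \<and> value_graph X s \<subseteq> \<A>"
    using assms unfolding envelope_def by (elim conjE)
  then obtain s where graph: "step_function X \<SS> s" "value_graph X s \<subseteq> \<A>" by (elim exE conjE)
  obtain J c E where s: "finite J" "E ` J \<subseteq> \<SS>" "\<forall>x\<in>X. s x = step_sum J c E x"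
    using graph(1) unfolding step_function_def by (elim exE conjE)
  then have "value_graph X (step_sum J c E) \<subseteq> \<A>"
    using graph(2) unfolding value_graph_def by auto
  with s(1,2) show ?thesis by (rule that)
qed

lemma step_integrals_nonempty:
  assumes "envelope X \<SS> \<A>"
  shows "step_integrals \<A> \<noteq> {}"
proof -
  obtain J c E where J: "finite J" "E ` J \<subseteq> \<SS>" "value_graph X (step_sum J c E) \<subseteq> \<A>"
    by (rule envelope_step[OF assms], rule that)
  then have "(\<Sum>j\<in>J. L (c j) (\<mu> (E j))) \<in> step_integrals \<A>"
    unfolding step_integrals_def by blast
  then show ?thesis by blast
qed

lemma step_sum_support:
  assumes "E ` J \<subseteq> \<SS>" "step_sum J c E x \<noteq> 0"
  shows "x \<in> X"
proof -
  have "\<exists>j\<in>J. x \<in> E j"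
  proof (rule ccontr)
    assume "\<not> (\<exists>j\<in>J. x \<in> E j)"
    then have "step_sum J c E x = 0" unfolding step_sum_def by (intro sum.neutral) simp
    then show False using assms(2) by contradiction
  qed
  moreover have "\<SS> \<subseteq> Pow X" using interval_system unfolding interval_system_def by (elim conjE)
  ultimately show ?thesis using assms(1) by blast
qed

lemma step_integral_near_common_sum:
  assumes T: "open T" "0 \<in> T"
    and A: "envelope X \<SS> \<A>" and C: "tiles \<SS> \<C> (\<Union>\<C>)"
    and vC: "\<And>K x. K \<in> \<C> \<Longrightarrow> x \<in> K \<Longrightarrow> (v K, x) \<in> \<A>"
    and D: "\<D> \<subseteq> \<SS>" "countable \<D>"
      "\<A> = (\<Union>D\<in>\<D>. common_values \<A> D \<times> D) \<union> {0} \<times> (X - \<Union>\<D>)"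
    and bad: "\<And>x. x \<in> \<Union>\<D> \<Longrightarrow> x \<in> X \<Longrightarrow> x \<notin> \<Union>\<C> \<Longrightarrow> \<exists>D\<in>\<D>. x \<in> D \<and> 0 \<in> common_values \<A> D"
  shows "\<exists>F0\<subseteq>\<C>. finite F0 \<and> (\<forall>F. finite F \<longrightarrow> F0 \<subseteq> F \<longrightarrow> F \<subseteq> \<C> \<longrightarrow>
    (\<exists>p\<in>step_integrals \<A>. p - (\<Sum>K\<in>F. L (v K) (\<mu> K)) \<in> T))"
proof -
  obtain J c E where J: "finite J" "E ` J \<subseteq> \<SS>" "value_graph X (step_sum J c E) \<subseteq> \<A>"
    by (rule envelope_step[OF A], rule that)
  \<comment> \<open>A nonzero value of the step function forces \<open>x\<close> into
    \<open>\<Union>\<D>\<close>, by the second clause of the envelope. Outside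
    \<open>\<Union>\<C>\<close>, the assumption \<open>bad\<close> then provides a set of
    \<open>\<B>\<close> around \<open>x\<close>.\<close>
  define \<B> where "\<B> = {D\<in>\<D>. 0 \<in> common_values \<A> D}"
  show ?thesis
  proof (rule step_integral_near_sum[OF T J C vC, where \<B> = \<B>])
    show "countable \<B>" "\<B> \<subseteq> \<SS>" unfolding \<B>_def using D(1,2) by auto
    show "(0, x) \<in> \<A>" if "K \<in> \<B>" "x \<in> K" for K x
      using that unfolding \<B>_def common_values_def by blast
    show "x \<in> \<Union>\<C> \<union> \<Union>\<B>" if x: "step_sum J c E x \<noteq> 0" for x
    proof -
      have X: "x \<in> X" using step_sum_support[OF J(2) x] .
      then have "(step_sum J c E x, x) \<in> \<A>" using J(3) unfolding value_graph_def by blast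
      then have xD: "x \<in> \<Union>\<D>" using x by (subst (asm) D(3)) blast
      show ?thesis
      proof (cases "x \<in> \<Union>\<C>")
        case False
        show ?thesis using bad[OF xD X False] unfolding \<B>_def by blast
      qed blast
    qed
  qed
qed

lemma envelopes_step_integrals_near:
  assumes A: "envelope X \<SS> \<A>" "approximates X \<A> f"
    and B: "envelope X \<SS> \<B>" "approximates X \<B> f"
    and T: "open T" "0 \<in> T"
  shows "\<exists>p\<in>step_integrals \<A>. \<exists>q\<in>step_integrals \<B>. p - q \<in> T"
proof -
  obtain \<D> where D: "\<D> \<subseteq> \<SS>" "countable \<D>"
    "\<A> = (\<Union>D\<in>\<D>. common_values \<A> D \<times> D) \<union> {0} \<times> (X - \<Union>\<D>)"
    using A(1) unfolding envelope_def by (elim exE conjE)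
  obtain \<E> where E: "\<E> \<subseteq> \<SS>" "countable \<E>"
    "\<B> = (\<Union>D\<in>\<E>. common_values \<B> D \<times> D) \<union> {0} \<times> (X - \<Union>\<E>)"
    using B(1) unfolding envelope_def by (elim exE conjE)
  have fA: "f x = 0 \<and> x \<notin> \<Union>\<D> \<or> (\<exists>D\<in>\<D>. x \<in> D \<and> f x \<in> common_values \<A> D)" if "x \<in> X" for x
  proof -
    have "(f x, x) \<in> \<A>" using A(2) that unfolding approximates_def value_graph_def by blast
    then show ?thesis by (subst (asm) D(3)) blast
  qed
  have fB: "f x = 0 \<and> x \<notin> \<Union>\<E> \<or> (\<exists>D\<in>\<E>. x \<in> D \<and> f x \<in> common_values \<B> D)" if "x \<in> X" for x
  proof -
    have "(f x, x) \<in> \<B>" using B(2) that unfolding approximates_def value_graph_def by blast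
    then show ?thesis by (subst (asm) E(3)) blast
  qed
  define I where "I = {(D, D'). D \<in> \<D> \<and> D' \<in> \<E> \<and> common_values \<A> D \<inter> common_values \<B> D' \<noteq> {}}"
  have "\<exists>P. tiles \<SS> P (fst i \<inter> snd i)" if "i \<in> I" for i
    by (rule tileable_Diff_Int_basic(2)) (use that D(1) E(1) in \<open>auto simp: I_def\<close>)
  then obtain P where P: "\<And>i. i \<in> I \<Longrightarrow> tiles \<SS> (P i) (fst i \<inter> snd i)" by metis
  have "I \<subseteq> \<D> \<times> \<E>" unfolding I_def by auto
  then have "countable I" using D(2) E(2) by (meson countable_SIGMA countable_subset)
  then have "countable (\<Union>i\<in>I. P i)" "(\<Union>i\<in>I. P i) \<subseteq> \<SS>" using P unfolding tiles_def by blast+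
  \<comment> \<open>For different \<open>i\<close> the intersections may overlap, so the families
    \<open>P i\<close> together need not be disjoint. Their union is tiled afresh inside their
    members, which keeps a pair \<open>i\<close> for every tile.\<close>
  from tileable_Union[OF this] obtain \<C> where C: "tiles \<SS> \<C> (\<Union>(\<Union>i\<in>I. P i))"
    "\<forall>K\<in>\<C>. \<exists>Q\<in>(\<Union>i\<in>I. P i). K \<subseteq> Q" by (elim exE conjE)
  have CU: "\<Union>\<C> = (\<Union>i\<in>I. fst i \<inter> snd i)"
  proof -
    have "\<Union>\<C> = (\<Union>i\<in>I. \<Union>(P i))" using C(1) unfolding tiles_def by blast
    also have "\<dots> = (\<Union>i\<in>I. fst i \<inter> snd i)"
    proof (rule SUP_cong)
      fix i assume "i \<in> I"
      then show "\<Union>(P i) = fst i \<inter> snd i" using P[of i] unfolding tiles_def by simp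
    qed simp
    finally show ?thesis .
  qed
  have tC: "tiles \<SS> \<C> (\<Union>\<C>)" using C(1) unfolding tiles_def by simp
  have "\<exists>v. \<forall>x\<in>K. (v, x) \<in> \<A> \<and> (v, x) \<in> \<B>" if K: "K \<in> \<C>" for K
  proof -
    obtain i Q where i: "i \<in> I" "Q \<in> P i" "K \<subseteq> Q" using C(2) K by blast
    have "Q \<subseteq> fst i \<inter> snd i" using P[OF i(1)] i(2) unfolding tiles_def by blast
    then have "K \<subseteq> fst i" "K \<subseteq> snd i" using i(3) by auto
    moreover obtain v where "v \<in> common_values \<A> (fst i)" "v \<in> common_values \<B> (snd i)"
      using i(1) unfolding I_def by auto
    ultimately have "\<forall>x\<in>K. (v, x) \<in> \<A> \<and> (v, x) \<in> \<B>" unfolding common_values_def by blast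
    then show ?thesis by (rule exI)
  qed
  then have "\<exists>v. \<forall>K\<in>\<C>. \<forall>x\<in>K. (v K, x) \<in> \<A> \<and> (v K, x) \<in> \<B>" by metis
  then obtain v where v: "\<forall>K\<in>\<C>. \<forall>x\<in>K. (v K, x) \<in> \<A> \<and> (v K, x) \<in> \<B>" by (elim exE)
  have in_C: "x \<in> \<Union>\<C>"
    if "D \<in> \<D>" "D' \<in> \<E>" "x \<in> D" "x \<in> D'" "u \<in> common_values \<A> D" "u \<in> common_values \<B> D'" for x D D' u
  proof -
    have "(D, D') \<in> I" using that unfolding I_def by blast
    then show ?thesis unfolding CU using that by (intro UN_I[of "(D, D')"]) auto
  qed
  obtain U where U: "open U" "0 \<in> U" "\<And>a. a \<in> U \<Longrightarrow> - a \<in> U"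
    "\<And>a b c. a \<in> U \<Longrightarrow> b \<in> U \<Longrightarrow> c \<in> U \<Longrightarrow> a + b + c \<in> T"
    by (rule symmetric_nbhd_three[OF T], rule that)
  have "\<exists>F0\<subseteq>\<C>. finite F0 \<and> (\<forall>F. finite F \<longrightarrow> F0 \<subseteq> F \<longrightarrow> F \<subseteq> \<C> \<longrightarrow>
    (\<exists>p\<in>step_integrals \<A>. p - (\<Sum>K\<in>F. L (v K) (\<mu> K)) \<in> U))"
  proof (rule step_integral_near_common_sum[OF U(1,2) A(1) tC _ D])
    show "(v K, x) \<in> \<A>" if "K \<in> \<C>" "x \<in> K" for K x using v that by blast
    show "\<exists>D\<in>\<D>. x \<in> D \<and> 0 \<in> common_values \<A> D" if x: "x \<in> \<Union>\<D>" "x \<in> X" "x \<notin> \<Union>\<C>" for x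
    proof -
      obtain D where D': "D \<in> \<D>" "x \<in> D" "f x \<in> common_values \<A> D" using fA x by blast
      \<comment> \<open>A set of \<open>\<E>\<close> around \<open>x\<close> with \<open>f x\<close>
        among its common values would put \<open>x\<close> into \<open>\<Union>\<C>\<close>. Only
        the other alternative of \<open>fB\<close> remains, so 0 is a common value on
        \<open>D\<close>.\<close>
      then have "f x = 0" using fB[OF x(2)] in_C x(3) by blast
      then show ?thesis using D' by auto
    qed
  qed
  then obtain FA where FA: "FA \<subseteq> \<C>" "finite FA"
    "\<forall>F. finite F \<longrightarrow> FA \<subseteq> F \<longrightarrow> F \<subseteq> \<C> \<longrightarrow>
      (\<exists>p\<in>step_integrals \<A>. p - (\<Sum>K\<in>F. L (v K) (\<mu> K)) \<in> U)" by (elim exE conjE)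
  have "\<exists>F0\<subseteq>\<C>. finite F0 \<and> (\<forall>F. finite F \<longrightarrow> F0 \<subseteq> F \<longrightarrow> F \<subseteq> \<C> \<longrightarrow>
    (\<exists>p\<in>step_integrals \<B>. p - (\<Sum>K\<in>F. L (v K) (\<mu> K)) \<in> U))"
  proof (rule step_integral_near_common_sum[OF U(1,2) B(1) tC _ E])
    show "(v K, x) \<in> \<B>" if "K \<in> \<C>" "x \<in> K" for K x using v that by blast
    show "\<exists>D\<in>\<E>. x \<in> D \<and> 0 \<in> common_values \<B> D" if x: "x \<in> \<Union>\<E>" "x \<in> X" "x \<notin> \<Union>\<C>" for x
    proof -
      obtain D where D': "D \<in> \<E>" "x \<in> D" "f x \<in> common_values \<B> D" using fB x by blast
      then have "f x = 0" using fA[OF x(2)] in_C x(3) by blast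
      then show ?thesis using D' by auto
    qed
  qed
  then obtain FB where FB: "FB \<subseteq> \<C>" "finite FB"
    "\<forall>F. finite F \<longrightarrow> FB \<subseteq> F \<longrightarrow> F \<subseteq> \<C> \<longrightarrow>
      (\<exists>p\<in>step_integrals \<B>. p - (\<Sum>K\<in>F. L (v K) (\<mu> K)) \<in> U)" by (elim exE conjE)
  let ?S = "\<Sum>K\<in>FA \<union> FB. L (v K) (\<mu> K)"
  have F: "finite (FA \<union> FB)" "FA \<union> FB \<subseteq> \<C>" using FA FB by auto
  obtain p where p: "p \<in> step_integrals \<A>" "p - ?S \<in> U" using FA(3) F by blast
  obtain q where q: "q \<in> step_integrals \<B>" "q - ?S \<in> U" using FB(3) F by blast
  have "(p - ?S) + - (q - ?S) + 0 \<in> T" by (intro U(2-4) p q)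
  moreover have "(p - ?S) + - (q - ?S) + 0 = p - q" by simp
  ultimately have "p - q \<in> T" by metis
  then show ?thesis using p(1) q(1) by blast
qed

end

section \<open>Uniqueness and the Cauchy criterion for the integral\<close>

theorem lemma5p2:
  fixes X :: "'x set" and \<SS> :: "'x set set"
    and \<mu> :: "'x set \<Rightarrow> 'w::{topological_ab_group_add, uniform_topological_group_add,
                               complete_uniform_space, t2_space}"
    and L :: "'v::{topological_ab_group_add, uniform_topological_group_add,
                   complete_uniform_space, t2_space} \<Rightarrow> 'w \<Rightarrow>
              'z::{topological_ab_group_add, uniform_topological_group_add,
                   complete_uniform_space, t2_space}"
    and f :: "'x \<Rightarrow> 'v"
  assumes "interval_system X \<SS>"
    and "interval_system_measure \<SS> \<mu>"
    and "biadditive L"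
    and "\<And>v. continuous_on UNIV (L v)"
  shows "(\<forall>a b. is_integral X \<SS> L \<mu> f a \<longrightarrow> is_integral X \<SS> L \<mu> f b \<longrightarrow> a = b) \<and>
    ((\<exists>a. is_integral X \<SS> L \<mu> f a) \<longleftrightarrow>
      (\<forall>T. 0 \<in> interior T \<longrightarrow>
        (\<exists>\<A>. envelope X \<SS> \<A> \<and> approximates X \<A> f \<and>
              {u - v | u v. u \<in> bilinear_sum X \<SS> L \<mu> \<A> \<and> v \<in> bilinear_sum X \<SS> L \<mu> \<A>} \<subseteq> T)))"
proof -
  interpret measure_pairing X \<SS> \<mu> L
    using assms by unfold_locales
  let ?S = "bilinear_sum X \<SS> L \<mu>"
  have unique: "a = b" if a: "is_integral X \<SS> L \<mu> f a" and b: "is_integral X \<SS> L \<mu> f b" for a b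
  proof (rule ccontr)
    assume "a \<noteq> b"
    \<comment> \<open>The neighborhood omits exactly \<open>a - b\<close>, which will be written as
      \<open>(p - q) - t + t'\<close> with all three terms in \<open>U\<close>.\<close>
    then have nb: "open (- {a - b})" "0 \<in> - {a - b}" by auto
    obtain U where U: "open U" "0 \<in> U" "\<And>t. t \<in> U \<Longrightarrow> - t \<in> U"
      "\<And>r s t. r \<in> U \<Longrightarrow> s \<in> U \<Longrightarrow> t \<in> U \<Longrightarrow> r + s + t \<in> - {a - b}"
      by (rule symmetric_nbhd_three[OF nb], rule that)
    have "0 \<in> interior U" using U(1,2) by (simp add: interior_open)
    then obtain \<A> \<B> where A: "envelope X \<SS> \<A>" "approximates X \<A> f" "?S \<A> \<subseteq> {a + t | t. t \<in> U}"
      and B: "envelope X \<SS> \<B>" "approximates X \<B> f" "?S \<B> \<subseteq> {b + t | t. t \<in> U}"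
      using a b unfolding is_integral_def by meson
    obtain p q where p: "p \<in> step_integrals \<A>" "q \<in> step_integrals \<B>" "p - q \<in> U"
      using envelopes_step_integrals_near[OF A(1,2) B(1,2) U(1,2)] by blast
    obtain t where t: "t \<in> U" "p = a + t" using p(1) A(3) step_integrals_subset by blast
    obtain t' where t': "t' \<in> U" "q = b + t'" using p(2) B(3) step_integrals_subset by blast
    have "(p - q) + - t + t' \<in> - {a - b}" by (intro U(3,4) p t t')
    then show False using t(2) t'(2) by (simp add: algebra_simps)
  qed
  have envelope_if_integral: "\<exists>\<A>. envelope X \<SS> \<A> \<and> approximates X \<A> f \<and> {u - v | u v. u \<in> ?S \<A> \<and> v \<in> ?S \<A>} \<subseteq> T"
    if a: "is_integral X \<SS> L \<mu> f a" and T: "0 \<in> interior T" for a T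
  proof -
    obtain U where U: "open U" "0 \<in> U" "\<And>t. t \<in> U \<Longrightarrow> - t \<in> U"
      "\<And>r s t. r \<in> U \<Longrightarrow> s \<in> U \<Longrightarrow> t \<in> U \<Longrightarrow> r + s + t \<in> interior T"
      by (rule symmetric_nbhd_three[OF open_interior T], rule that)
    have "0 \<in> interior U" using U(1,2) by (simp add: interior_open)
    then obtain \<A> where A: "envelope X \<SS> \<A>" "approximates X \<A> f" "?S \<A> \<subseteq> {a + t | t. t \<in> U}"
      using a unfolding is_integral_def by meson
    have "u - v \<in> T" if uv: "u \<in> ?S \<A>" "v \<in> ?S \<A>" for u v
    proof -
      obtain t t' where t: "t \<in> U" "t' \<in> U" "u = a + t" "v = a + t'" using uv A(3) by blast
      have "t + - t' + 0 \<in> interior T" by (intro U(2-4) t)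
      then show ?thesis using interior_subset t(3,4) by auto
    qed
    then have "{u - v | u v. u \<in> ?S \<A> \<and> v \<in> ?S \<A>} \<subseteq> T" by blast
    then show ?thesis using A(1,2) by (intro exI[of _ \<A>] conjI)
  qed
  have integral_if: "\<exists>a. is_integral X \<SS> L \<mu> f a"
    if cau: "\<forall>T. 0 \<in> interior T \<longrightarrow> (\<exists>\<A>. envelope X \<SS> \<A> \<and> approximates X \<A> f \<and>
      {u - v | u v. u \<in> ?S \<A> \<and> v \<in> ?S \<A>} \<subseteq> T)"
  proof -
    define good where "good V \<A> p \<longleftrightarrow> envelope X \<SS> \<A> \<and> approximates X \<A> f \<and>
      (\<forall>u\<in>?S \<A>. \<forall>v\<in>?S \<A>. u - v \<in> V) \<and> p \<in> step_integrals \<A>" for V \<A> p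
    have "\<exists>\<A> p. good V \<A> p" if V: "open_nbhd V" for V
    proof -
      have "0 \<in> interior V" using V by (simp add: open_nbhd_def interior_open)
      then obtain \<A> where A: "envelope X \<SS> \<A>" "approximates X \<A> f"
        "{u - v | u v. u \<in> ?S \<A> \<and> v \<in> ?S \<A>} \<subseteq> V" using cau by meson
      obtain p where "p \<in> step_integrals \<A>" using step_integrals_nonempty[OF A(1)] by blast
      moreover have "\<forall>u\<in>?S \<A>. \<forall>v\<in>?S \<A>. u - v \<in> V" using A(3) by blast
      ultimately have "good V \<A> p" unfolding good_def using A(1,2) by simp
      then show ?thesis by blast
    qed
    then obtain \<A> p where "\<And>V. open_nbhd V \<Longrightarrow> good V (\<A> V) (p V)" by metis
    then have env: "envelope X \<SS> (\<A> V)" "approximates X (\<A> V) f"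
      and diff: "u \<in> ?S (\<A> V) \<Longrightarrow> v \<in> ?S (\<A> V) \<Longrightarrow> u - v \<in> V"
      and p: "p V \<in> step_integrals (\<A> V)" if "open_nbhd V" for V u v
      using that unfolding good_def by simp_all
    have "\<exists>a. \<forall>U. open_nbhd U \<longrightarrow> (\<exists>W. open_nbhd W \<and> (\<forall>V. open_nbhd V \<longrightarrow> V \<subseteq> W \<longrightarrow> p V - a \<in> U))"
    proof (rule cauchy_net_nbhds_converges)
      fix T :: "'z set" assume "open_nbhd T"
      then have T: "open T" "0 \<in> T" unfolding open_nbhd_def by auto
      obtain U where U: "open U" "0 \<in> U" "\<And>t. t \<in> U \<Longrightarrow> - t \<in> U"
        "\<And>r s t. r \<in> U \<Longrightarrow> s \<in> U \<Longrightarrow> t \<in> U \<Longrightarrow> r + s + t \<in> T"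
        by (rule symmetric_nbhd_three[OF T], rule that)
      have "p W - p V \<in> T" if V: "open_nbhd V" "V \<subseteq> U" and W: "open_nbhd W" "W \<subseteq> U" for V W
      proof -
        obtain r s where rs: "r \<in> step_integrals (\<A> W)" "s \<in> step_integrals (\<A> V)" "r - s \<in> U"
          using envelopes_step_integrals_near[OF env[OF W(1)] env[OF V(1)] U(1,2)] by blast
        \<comment> \<open>Only some pair \<open>r\<close>, \<open>s\<close> is known to be close.
          The chosen \<open>p W\<close> and \<open>p V\<close> are compared with it inside their own
          envelopes, whose differences lie in \<open>W\<close> and \<open>V\<close>.\<close>
        have "p W - r \<in> W" "s - p V \<in> V"
          by (intro diff[OF W(1)] diff[OF V(1)] subsetD[OF step_integrals_subset] p rs V(1) W(1))+
        then have "(p W - r) + (r - s) + (s - p V) \<in> T"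
          by (intro U(4) rs(3) subsetD[OF V(2)] subsetD[OF W(2)])
        then show ?thesis by simp
      qed
      then show "\<exists>U. open_nbhd U \<and>
          (\<forall>V W. open_nbhd V \<longrightarrow> V \<subseteq> U \<longrightarrow> open_nbhd W \<longrightarrow> W \<subseteq> U \<longrightarrow> p W - p V \<in> T)"
        using U(1,2) by (intro exI[of _ U]) (simp add: open_nbhd_def)
    qed
    then obtain a where a: "\<forall>U. open_nbhd U \<longrightarrow>
      (\<exists>W. open_nbhd W \<and> (\<forall>V. open_nbhd V \<longrightarrow> V \<subseteq> W \<longrightarrow> p V - a \<in> U))" by (elim exE)
    have "is_integral X \<SS> L \<mu> f a"
      unfolding is_integral_def
    proof (intro allI impI)
      fix T :: "'z set" assume T: "0 \<in> interior T"
      obtain U where U: "open U" "0 \<in> U" "\<And>t. t \<in> U \<Longrightarrow> - t \<in> U"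
        "\<And>r s t. r \<in> U \<Longrightarrow> s \<in> U \<Longrightarrow> t \<in> U \<Longrightarrow> r + s + t \<in> interior T"
        by (rule symmetric_nbhd_three[OF open_interior T], rule that)
      have oU: "open_nbhd U" using U(1,2) by (simp add: open_nbhd_def)
      obtain W where W: "open_nbhd W" "\<forall>V. open_nbhd V \<longrightarrow> V \<subseteq> W \<longrightarrow> p V - a \<in> U"
        using a[rule_format, OF oU] by (elim exE conjE)
      \<comment> \<open>\<open>W\<close> brings \<open>p V\<close> close to \<open>a\<close>, while
        \<open>U\<close> keeps the whole bilinear sum of the chosen envelope close to
        \<open>p V\<close>.\<close>
      define V where "V = W \<inter> U"
      have V: "open_nbhd V" "V \<subseteq> U" "p V - a \<in> U"
        using open_nbhd_Int[OF W(1) oU] W(2) by (auto simp: V_def)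
      have near: "x - a \<in> T" if x: "x \<in> ?S (\<A> V)" for x
      proof -
        have "x - p V \<in> V" by (intro diff[OF V(1) x] subsetD[OF step_integrals_subset] p V(1))
        then have "(x - p V) + (p V - a) + 0 \<in> interior T"
          by (intro U(2,4) V(3) subsetD[OF V(2)])
        then show ?thesis using interior_subset by auto
      qed
      have "?S (\<A> V) \<subseteq> {a + t | t. t \<in> T}"
      proof
        fix x assume "x \<in> ?S (\<A> V)"
        then have "x - a \<in> T" "x = a + (x - a)" using near by simp_all
        then show "x \<in> {a + t | t. t \<in> T}" by blast
      qed
      then show "\<exists>\<A>. envelope X \<SS> \<A> \<and> approximates X \<A> f \<and> ?S \<A> \<subseteq> {a + t | t. t \<in> T}"
        using env[OF V(1)] by (intro exI[of _ "\<A> V"] conjI)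
    qed
    then show ?thesis by (rule exI)
  qed
  show ?thesis
  proof (intro conjI allI impI iffI)
    fix T :: "'z set"
    assume "\<exists>a. is_integral X \<SS> L \<mu> f a" and T: "0 \<in> interior T"
    then obtain a where "is_integral X \<SS> L \<mu> f a" by (elim exE)
    from envelope_if_integral[OF this T]
    show "\<exists>\<A>. envelope X \<SS> \<A> \<and> approximates X \<A> f \<and> {u - v | u v. u \<in> ?S \<A> \<and> v \<in> ?S \<A>} \<subseteq> T" .
  qed (fact unique, rule integral_if)
qed

end
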